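(* Let $K$ be an infinite field and, for an integer $n\ge 2$, let $F_n$ denote a free (non-abelian) group of rank $n$. Then for all integers $n,m\ge 2$ with $n\neq m$, the group algebras $K(F_n)$ and $K(F_m)$ are not elementarily equivalent, i.e. $K(F_n)\not\equiv K(F_m)$.
   Context: Group algebras are viewed as structures in the language of unitary rings $\{+,\cdot,0,1\}$; two structures are elementarily equivalent ($\equiv$) if they satisfy the same first-order sentences. *)

theory Defs
  imports "HOL-Algebra.Ring"
begin
datatype rterm =
    Var nat
  | Zero
  | One
  | Add rterm rterm
  | Mult rterm rterm

datatype rform =
    Eq rterm rterm
  | Neg rform
  | Conj rform rform
  | Exists nat rform

primrec term_vars :: "rterm \<Rightarrow> nat set" where
  "term_vars (Var x) = {x}"
| "term_vars Zero = {}"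
| "term_vars One = {}"
| "term_vars (Add s t) = term_vars s \<union> term_vars t"
| "term_vars (Mult s t) = term_vars s \<union> term_vars t"

primrec free_vars :: "rform \<Rightarrow> nat set" where
  "free_vars (Eq s t) = term_vars s \<union> term_vars t"
| "free_vars (Neg p) = free_vars p"
| "free_vars (Conj p q) = free_vars p \<union> free_vars q"
| "free_vars (Exists x p) = free_vars p - {x}"

definition sentence :: "rform \<Rightarrow> bool" where
  "sentence p \<longleftrightarrow> free_vars p = {}"

primrec term_val :: "('a, 'x) ring_scheme \<Rightarrow> (nat \<Rightarrow> 'a) \<Rightarrow> rterm \<Rightarrow> 'a" where
  "term_val R e (Var x) = e x"
| "term_val R e Zero = \<zero>\<^bsub>R\<^esub>"
| "term_val R e One = \<one>\<^bsub>R\<^esub>"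
| "term_val R e (Add s t) = term_val R e s \<oplus>\<^bsub>R\<^esub> term_val R e t"
| "term_val R e (Mult s t) = term_val R e s \<otimes>\<^bsub>R\<^esub> term_val R e t"

primrec sat :: "('a, 'x) ring_scheme \<Rightarrow> (nat \<Rightarrow> 'a) \<Rightarrow> rform \<Rightarrow> bool" where
  "sat R e (Eq s t) \<longleftrightarrow> term_val R e s = term_val R e t"
| "sat R e (Neg p) \<longleftrightarrow> \<not> sat R e p"
| "sat R e (Conj p q) \<longleftrightarrow> sat R e p \<and> sat R e q"
| "sat R e (Exists x p) \<longleftrightarrow> (\<exists>a\<in>carrier R. sat R (e(x := a)) p)"

text \<open>The truth of a sentence does not depend on the assignment, so for a sentence and a
  nonempty carrier the universal quantifier below could equally be existential.\<close>

definition models :: "('a, 'x) ring_scheme \<Rightarrow> rform \<Rightarrow> bool" where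
  "models R p \<longleftrightarrow> (\<forall>e. range e \<subseteq> carrier R \<longrightarrow> sat R e p)"

definition elementarily_equivalent ::
    "('a, 'x) ring_scheme \<Rightarrow> ('b, 'y) ring_scheme \<Rightarrow> bool" where
  "elementarily_equivalent R S \<longleftrightarrow>
     (\<forall>p. sentence p \<longrightarrow> (models R p \<longleftrightarrow> models S p))"

text \<open>The letter \<open>(x, True)\<close> stands for the generator \<open>x\<close>, and \<open>(x, False)\<close> for its
  formal inverse. Elements of the free group are the reduced words, multiplied by
  concatenation followed by free reduction.\<close>

type_synonym 'a letter = "'a \<times> bool"

definition inv_letter :: "'a letter \<Rightarrow> 'a letter" where
  "inv_letter a = (fst a, \<not> snd a)"

fun reduced :: "'a letter list \<Rightarrow> bool" where
  "reduced [] \<longleftrightarrow> True"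
| "reduced [a] \<longleftrightarrow> True"
| "reduced (a # b # w) \<longleftrightarrow> b \<noteq> inv_letter a \<and> reduced (b # w)"

definition cancel_cons :: "'a letter \<Rightarrow> 'a letter list \<Rightarrow> 'a letter list" where
  "cancel_cons a w = (if w \<noteq> [] \<and> hd w = inv_letter a then tl w else a # w)"

definition reduce :: "'a letter list \<Rightarrow> 'a letter list" where
  "reduce w = foldr cancel_cons w []"

definition free_group :: "'a set \<Rightarrow> 'a letter list monoid" where
  "free_group X =
     \<lparr>carrier = {w \<in> lists (X \<times> UNIV). reduced w},
      mult = (\<lambda>u v. reduce (u @ v)),
      one = []\<rparr>"

lemma inv_letter_inv_letter [simp]: "inv_letter (inv_letter a) = a"
  by (simp add: inv_letter_def)

lemma reduced_tl: "reduced (a # w) \<Longrightarrow> reduced w"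
  by (cases w) auto

lemma reduced_cancel_cons: "reduced w \<Longrightarrow> reduced (cancel_cons a w)"
  by (cases w) (auto simp: cancel_cons_def dest: reduced_tl)

lemma reduced_foldr: "reduced v \<Longrightarrow> reduced (foldr cancel_cons u v)"
  by (induction u) (auto intro: reduced_cancel_cons)

lemma reduced_reduce: "reduced (reduce w)"
  by (simp add: reduce_def reduced_foldr)

lemma reduce_reduced: "reduced w \<Longrightarrow> reduce w = w"
proof (induction w)
  case (Cons a w)
  then show ?case
    by (cases w) (auto simp: reduce_def cancel_cons_def dest: reduced_tl)
qed (simp add: reduce_def)

lemma cancel_cons_inv: "reduced w \<Longrightarrow> cancel_cons (inv_letter a) (cancel_cons a w) = w"
proof (cases w)
  case (Cons b v)
  assume "reduced w"
  then show ?thesis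
    using Cons by (cases v) (auto simp: cancel_cons_def)
qed (simp add: cancel_cons_def)

lemma foldr_cancel_cons:
  "reduced v \<Longrightarrow> foldr cancel_cons (cancel_cons a u) v = cancel_cons a (foldr cancel_cons u v)"
proof (cases "u \<noteq> [] \<and> hd u = inv_letter a")
  case True
  assume v: "reduced v"
  from True have "u = inv_letter a # tl u"
    by (cases u) auto
  moreover have "cancel_cons a u = tl u"
    using True by (simp add: cancel_cons_def)
  ultimately show ?thesis
    using cancel_cons_inv[OF reduced_foldr[OF v], of "inv_letter a" "tl u"]
    by (metis foldr_Cons comp_apply inv_letter_inv_letter)
next
  case False
  then have "cancel_cons a u = a # u"
    by (auto simp: cancel_cons_def)
  then show ?thesis by simp
qed

lemma foldr_reduce: "reduced v \<Longrightarrow> foldr cancel_cons (reduce u) v = foldr cancel_cons u v"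
  by (induction u) (auto simp: reduce_def foldr_cancel_cons)

lemma reduce_append_left: "reduce (reduce u @ v) = reduce (u @ v)"
  using foldr_reduce[OF reduced_reduce, of u v] by (simp add: reduce_def)

lemma reduce_append_right: "reduce (u @ reduce v) = reduce (u @ v)"
  using reduce_reduced[OF reduced_reduce, of v] by (simp add: reduce_def)

lemma set_cancel_cons: "set (cancel_cons a w) \<subseteq> insert a (set w)"
  by (cases w) (auto simp: cancel_cons_def)

lemma set_reduce: "set (reduce w) \<subseteq> set w"
proof (induction w)
  case (Cons a w)
  then show ?case
    using set_cancel_cons[of a "reduce w"] by (auto simp: reduce_def)
qed (simp add: reduce_def)

lemma reduce_inverse: "reduce (rev (map inv_letter w) @ w) = []"
proof (induction w)
  case (Cons a w)
  have "cancel_cons (inv_letter a) (cancel_cons a (reduce w)) = reduce w"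
    by (rule cancel_cons_inv[OF reduced_reduce])
  with Cons show ?case by (simp add: reduce_def)
qed (simp add: reduce_def)

lemma group_free_group: "group (free_group X)"
proof (rule groupI)
  fix u assume u: "u \<in> carrier (free_group X)"
  let ?v = "reduce (rev (map inv_letter u))"
  have "set ?v \<subseteq> X \<times> UNIV"
    using set_reduce[of "rev (map inv_letter u)"] u
    by (fastforce simp: free_group_def inv_letter_def)
  then have "?v \<in> carrier (free_group X)"
    by (auto simp: free_group_def reduced_reduce)
  moreover have "?v \<otimes>\<^bsub>free_group X\<^esub> u = \<one>\<^bsub>free_group X\<^esub>"
    by (simp add: free_group_def reduce_append_left reduce_inverse)
  ultimately show "\<exists>v\<in>carrier (free_group X). v \<otimes>\<^bsub>free_group X\<^esub> u = \<one>\<^bsub>free_group X\<^esub>"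
    by blast
next
  fix u v assume "u \<in> carrier (free_group X)" "v \<in> carrier (free_group X)"
  then show "u \<otimes>\<^bsub>free_group X\<^esub> v \<in> carrier (free_group X)"
    using set_reduce[of "u @ v"] by (auto simp: free_group_def reduced_reduce)
qed (auto simp: free_group_def reduce_append_left reduce_append_right reduce_reduced)

definition free_group_of_rank :: "nat \<Rightarrow> ('g, 'y) monoid_scheme \<Rightarrow> bool" where
  "free_group_of_rank n G \<longleftrightarrow> group G \<and> G \<cong> free_group {..<n}"

text \<open>Elements are the finitely supported functions from \<open>G\<close> to \<open>K\<close> (extensional, that is,
  \<open>undefined\<close> outside \<open>carrier G\<close>). Multiplication is convolution
  \<open>(f h)(g) = \<Sum>x. f x h (x\<inverse> g)\<close>; the sum is restricted to the support of \<open>f\<close> because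
  \<open>finsum\<close> does not have the intended meaning on infinite sets.\<close>

definition group_algebra ::
    "('k, 'x) ring_scheme \<Rightarrow> ('g, 'y) monoid_scheme \<Rightarrow> ('g \<Rightarrow> 'k) ring" where
  "group_algebra K G =
     \<lparr>carrier = {f \<in> carrier G \<rightarrow>\<^sub>E carrier K. finite {g \<in> carrier G. f g \<noteq> \<zero>\<^bsub>K\<^esub>}},
      mult = (\<lambda>f h. \<lambda>g\<in>carrier G.
        \<Oplus>\<^bsub>K\<^esub>x\<in>{x \<in> carrier G. f x \<noteq> \<zero>\<^bsub>K\<^esub>}. f x \<otimes>\<^bsub>K\<^esub> h (inv\<^bsub>G\<^esub> x \<otimes>\<^bsub>G\<^esub> g)),
      one = (\<lambda>g\<in>carrier G. if g = \<one>\<^bsub>G\<^esub> then \<one>\<^bsub>K\<^esub> else \<zero>\<^bsub>K\<^esub>),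
      zero = (\<lambda>g\<in>carrier G. \<zero>\<^bsub>K\<^esub>),
      add = (\<lambda>f h. \<lambda>g\<in>carrier G. f g \<oplus>\<^bsub>K\<^esub> h g)\<rparr>"

end

theory Submission imports Defs begin

text \<open>For each \<open>n\<close> there is a first-order sentence which holds in \<open>K(F)\<close>, for \<open>F\<close> free of rank
  \<open>m \<ge> 2\<close>, if \<open>m = n\<close> and fails if \<open>m > n\<close>. It says that some \<open>n\<close> elements generate a right ideal \<open>I\<close>
  that does not contain \<open>1\<close>, while every element of the ring is the sum of a central element and an
  element of \<open>I\<close>. Of two different ranks, the sentence for the smaller one separates the two
  group algebras.

  The sentence is useful because the centre of \<open>R = K(F)\<close> consists of the scalars
  (\<open>center_eq_scalars\<close>): a central element is constant on conjugacy classes, but every nontrivial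
  reduced word has a longer conjugate, so a finite support closed under conjugation can only contain
  the identity. The sentence therefore speaks of right ideals with \<open>R = K \<oplus> I\<close>, although \<open>K\<close> is not
  named in the language.

  If \<open>x\<^sub>1, \<dots>, x\<^sub>n\<close> is a basis of \<open>F\<close>, the augmentation ideal, generated by the \<open>x\<^sub>i - 1\<close>, is
  such an ideal (\<open>free_basis_imp_complement\<close>).

  Conversely let \<open>F\<close> have the basis \<open>x\<^sub>1, \<dots>, x\<^sub>m\<close> and let \<open>v\<^sub>1, \<dots>, v\<^sub>n\<close> generate an ideal \<open>I\<close> as in
  the sentence. The projection of \<open>R = K \<oplus> I\<close> to \<open>K\<close> is multiplicative; it is the linear extension
  of a character \<open>\<chi>\<close> of \<open>F\<close>, and it vanishes on \<open>I\<close> (\<open>complement_character\<close>). The dimension of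
  \<open>I / I\<^sup>2\<close> is at most \<open>n\<close>, since \<open>v\<^sub>k (c + s) = c v\<^sub>k\<close> modulo \<open>I\<^sup>2\<close> for a scalar \<open>c\<close> and \<open>s \<in> I\<close>,
  and it is at least \<open>m\<close>, since \<open>m\<close> derivations separate the elements \<open>x\<^sub>i - \<chi>(x\<^sub>i)\<close> of \<open>I\<close>. If
  \<open>e\<^sub>j\<close> is the exponent sum of \<open>x\<^sub>j\<close>, a homomorphism to the additive group, then
  \<open>D\<^sub>j(f) = \<Sum>\<^sub>g f(g) \<chi>(g) e\<^sub>j(g)\<close> satisfies \<open>D\<^sub>j(f h) = D\<^sub>j(f) \<chi>(h) + \<chi>(f) D\<^sub>j(h)\<close> and
  \<open>D\<^sub>j(x\<^sub>i - \<chi>(x\<^sub>i)) = \<delta>\<^sub>i\<^sub>j \<chi>(x\<^sub>i)\<close>. Concretely, writing \<open>x\<^sub>i - \<chi>(x\<^sub>i) = \<Sum>\<^sub>k v\<^sub>k s\<^sub>i\<^sub>k\<close> and applying \<open>D\<^sub>j\<close>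
  gives \<open>\<Sum>\<^sub>k \<chi>(s\<^sub>i\<^sub>k) D\<^sub>j(v\<^sub>k) = \<delta>\<^sub>i\<^sub>j \<chi>(x\<^sub>i)\<close>, an invertible diagonal \<open>m \<times> m\<close> matrix that factors
  through \<open>K\<^sup>n\<close>; hence \<open>m \<le> n\<close> (\<open>complement_imp_rank_le\<close>).

  The ring axioms and the product rules of characters and derivations come from the functionals
  \<open>lin_ext \<phi> f = \<Sum>\<^sub>g f(g) \<phi>(g)\<close>, which turn the convolution product into
  an iterated sum over \<open>\<phi>(x y)\<close> (\<open>lin_ext_mult\<close>).\<close>

section \<open>Homogeneous linear systems\<close>

lemma (in abelian_monoid) finsum_swap:
  assumes "finite I" "finite J" "\<And>i j. i \<in> I \<Longrightarrow> j \<in> J \<Longrightarrow> f i j \<in> carrier G"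
  shows "(\<Oplus>i\<in>I. \<Oplus>j\<in>J. f i j) = (\<Oplus>j\<in>J. \<Oplus>i\<in>I. f i j)"
  using assms(1,3)
proof (induction I)
  case (insert i I)
  have "(\<Oplus>i'\<in>insert i I. \<Oplus>j\<in>J. f i' j) = (\<Oplus>j\<in>J. f i j) \<oplus> (\<Oplus>j\<in>J. \<Oplus>i'\<in>I. f i' j)"
    using insert by (simp add: finsum_insert Pi_iff finsum_closed)
  also have "\<dots> = (\<Oplus>j\<in>J. f i j \<oplus> (\<Oplus>i'\<in>I. f i' j))"
    using insert.prems by (subst finsum_addf) (auto intro!: finsum_closed)
  also have "\<dots> = (\<Oplus>j\<in>J. \<Oplus>i'\<in>insert i I. f i' j)"
    using insert by (intro finsum_cong') (auto simp: finsum_insert Pi_iff intro!: finsum_closed)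
  finally show ?case .
qed simp

text \<open>Gaussian elimination: if some row \<open>p\<close> has a nonzero entry in the last column, adding multiples
  of it clears that column in the other rows, and a relation among those rows lifts to a relation
  among all of them.\<close>

lemma (in field) homogeneous_system:
  fixes a :: "'i \<Rightarrow> nat \<Rightarrow> 'a"
  assumes "finite I" "n < card I" "\<And>i k. i \<in> I \<Longrightarrow> k < n \<Longrightarrow> a i k \<in> carrier R"
  shows "\<exists>y. y \<in> I \<rightarrow> carrier R \<and> (\<exists>i\<in>I. y i \<noteq> \<zero>) \<and>
           (\<forall>k<n. (\<Oplus>i\<in>I. y i \<otimes> a i k) = \<zero>)"
  using assms
proof (induction n arbitrary: I a)
  case 0
  then obtain i where "i \<in> I" by fastforce
  then show ?case by (intro exI[of _ "\<lambda>_. \<one>"]) auto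
next
  case (Suc n)
  show ?case
  proof (cases "\<forall>i\<in>I. a i n = \<zero>")
    case True
    obtain y where y: "y \<in> I \<rightarrow> carrier R" "\<exists>i\<in>I. y i \<noteq> \<zero>"
        "\<forall>k<n. (\<Oplus>i\<in>I. y i \<otimes> a i k) = \<zero>"
      using Suc.IH[of I a] Suc.prems by auto
    moreover have "(\<Oplus>i\<in>I. y i \<otimes> a i n) = \<zero>"
      using True y(1) by (intro add.finprod_one_eqI) (auto simp: Pi_iff)
    ultimately show ?thesis
      by (auto simp: less_Suc_eq)
  next
    case False
    then obtain p where p: "p \<in> I" "a p n \<noteq> \<zero>" by blast
    let ?J = "I - {p}"
    have pc: "a p k \<in> carrier R" if "k < Suc n" for k using p Suc.prems(3) that by blast
    have pinv: "inv (a p n) \<in> carrier R" "inv (a p n) \<otimes> a p n = \<one>"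
      using p pc[of n] field_Units by (auto intro!: Units_inv_closed Units_l_inv)
    \<comment> \<open>Adding \<open>t i\<close> times row \<open>p\<close> to row \<open>i\<close> clears column \<open>n\<close>.\<close>
    define t where "t i = \<ominus> (a i n \<otimes> inv (a p n))" for i
    have t: "t i \<in> carrier R" "t i \<otimes> a p n = \<ominus> a i n" if "i \<in> I" for i
      using Suc.prems(3)[OF that, of n] pinv pc[of n] by (auto simp: t_def l_minus m_assoc)
    define b where "b i k = a i k \<oplus> t i \<otimes> a p k" for i k
    have bc: "b i k \<in> carrier R" if "i \<in> I" "k < Suc n" for i k
      using that Suc.prems(3) t pc by (auto simp: b_def)
    obtain y where y: "y \<in> ?J \<rightarrow> carrier R" "\<exists>i\<in>?J. y i \<noteq> \<zero>"
        "\<forall>k<n. (\<Oplus>i\<in>?J. y i \<otimes> b i k) = \<zero>"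
    proof -
      have "n < card ?J" using Suc.prems(1,2) p(1) by simp
      then show ?thesis using Suc.IH[of ?J b] Suc.prems(1) bc that by auto
    qed
    define yp where "yp = (\<Oplus>i\<in>?J. y i \<otimes> t i)"
    have ypc: "yp \<in> carrier R"
      unfolding yp_def using y(1) t(1) by (intro finsum_closed) (auto simp: Pi_iff)
    let ?z = "y(p := yp)"
    have zero_b: "(\<Oplus>i\<in>?J. y i \<otimes> b i k) = \<zero>" if "k < Suc n" for k
    proof (cases "k = n")
      case True
      have "b i n = \<zero>" if "i \<in> I" for i
        using that Suc.prems(3)[OF that, of n] t[OF that] by (simp add: b_def r_neg)
      then show ?thesis
        using True y(1) by (intro add.finprod_one_eqI) (auto simp: Pi_iff)
    next
      case False
      then show ?thesis using that y(3) by simp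
    qed
    have "(\<Oplus>i\<in>I. ?z i \<otimes> a i k) = \<zero>" if k: "k < Suc n" for k
    proof -
      have ac: "a i k \<in> carrier R" if "i \<in> I" for i using Suc.prems(3) that k by blast
      have yc: "y i \<in> carrier R" if "i \<in> I" "i \<noteq> p" for i using y(1) that by auto
      have "(\<Oplus>i\<in>I. ?z i \<otimes> a i k) = (\<Oplus>i\<in>insert p ?J. ?z i \<otimes> a i k)"
        using p(1) by (simp add: insert_absorb)
      also have "\<dots> = yp \<otimes> a p k \<oplus> (\<Oplus>i\<in>?J. ?z i \<otimes> a i k)"
        using Suc.prems(1) p(1) ypc yc ac by (subst finsum_insert) auto
      also have "(\<Oplus>i\<in>?J. ?z i \<otimes> a i k) = (\<Oplus>i\<in>?J. y i \<otimes> a i k)"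
        using yc ac by (intro finsum_cong') auto
      also have "yp \<otimes> a p k = (\<Oplus>i\<in>?J. y i \<otimes> t i \<otimes> a p k)"
        unfolding yp_def using Suc.prems(1) yc t(1) pc[OF k] by (intro finsum_ldistr) auto
      also have "(\<Oplus>i\<in>?J. y i \<otimes> t i \<otimes> a p k) \<oplus> (\<Oplus>i\<in>?J. y i \<otimes> a i k)
          = (\<Oplus>i\<in>?J. y i \<otimes> t i \<otimes> a p k \<oplus> y i \<otimes> a i k)"
        using yc t(1) ac pc[OF k] by (intro finsum_addf[symmetric]) auto
      also have "\<dots> = (\<Oplus>i\<in>?J. y i \<otimes> b i k)"
        using yc t(1) ac pc[OF k] bc[OF _ k]
        by (intro finsum_cong') (auto simp: b_def r_distr m_assoc a_comm)
      finally show ?thesis using zero_b[OF k] by simp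
    qed
    moreover have "?z \<in> I \<rightarrow> carrier R"
      using y(1) ypc by (auto simp: Pi_iff)
    moreover have "\<exists>i\<in>I. ?z i \<noteq> \<zero>"
      using y(2) by auto
    ultimately show ?thesis by blast
  qed
qed

text \<open>An invertible diagonal matrix of size \<open>m\<close> has rank \<open>m\<close>, so it cannot factor through a space
  of smaller dimension: a row vector killed by the first factor would be killed by the product.\<close>

lemma (in field) diagonal_factorization_bound:
  fixes m n :: nat
  assumes a: "\<And>i k. i < m \<Longrightarrow> k < n \<Longrightarrow> a i k \<in> carrier R"
    and b: "\<And>k j. k < n \<Longrightarrow> j < m \<Longrightarrow> b k j \<in> carrier R"
    and d: "\<And>i. i < m \<Longrightarrow> d i \<in> carrier R - {\<zero>}"
    and prod: "\<And>i j. i < m \<Longrightarrow> j < m \<Longrightarrow>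
        (\<Oplus>k\<in>{..<n}. a i k \<otimes> b k j) = (if i = j then d i else \<zero>)"
  shows "m \<le> n"
proof (rule ccontr)
  assume "\<not> m \<le> n"
  then obtain y where y: "y \<in> {..<m} \<rightarrow> carrier R" "\<exists>i\<in>{..<m}. y i \<noteq> \<zero>"
      "\<forall>k<n. (\<Oplus>i\<in>{..<m}. y i \<otimes> a i k) = \<zero>"
    using homogeneous_system[of "{..<m}" n a] a by auto
  then obtain j where j: "j < m" "y j \<noteq> \<zero>" by auto
  have yc: "y i \<in> carrier R" if "i < m" for i using y(1) that by auto
  have "y j \<otimes> d j = (\<Oplus>i\<in>{..<m}. if j = i then y i \<otimes> d i else \<zero>)"
    using j d yc by (intro finsum_singleton[symmetric]) auto
  also have "\<dots> = (\<Oplus>i\<in>{..<m}. y i \<otimes> (\<Oplus>k\<in>{..<n}. a i k \<otimes> b k j))"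
    using j d yc by (intro finsum_cong') (auto simp: prod)
  also have "\<dots> = (\<Oplus>i\<in>{..<m}. \<Oplus>k\<in>{..<n}. y i \<otimes> a i k \<otimes> b k j)"
  proof (intro finsum_cong' refl)
    fix i assume "i \<in> {..<m}"
    then show "y i \<otimes> (\<Oplus>k\<in>{..<n}. a i k \<otimes> b k j) = (\<Oplus>k\<in>{..<n}. y i \<otimes> a i k \<otimes> b k j)"
      using a b j yc by (subst finsum_rdistr) (auto intro!: finsum_cong' simp: m_assoc)
  qed (use a b j yc in \<open>auto intro!: finsum_closed\<close>)
  also have "\<dots> = (\<Oplus>k\<in>{..<n}. \<Oplus>i\<in>{..<m}. y i \<otimes> a i k \<otimes> b k j)"
    using a b j yc by (intro finsum_swap) auto
  also have "\<dots> = \<zero>"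
  proof (rule add.finprod_one_eqI)
    fix k assume k: "k \<in> {..<n}"
    then have "(\<Oplus>i\<in>{..<m}. y i \<otimes> a i k \<otimes> b k j) = (\<Oplus>i\<in>{..<m}. y i \<otimes> a i k) \<otimes> b k j"
      using a b j yc by (intro finsum_ldistr[symmetric]) auto
    with k y(3) b j show "(\<Oplus>i\<in>{..<m}. y i \<otimes> a i k \<otimes> b k j) = \<zero>" by simp
  qed
  finally show False
    using j d[of j] yc integral by blast
qed

section \<open>Finitely generated right ideals\<close>

text \<open>Right ideals rather than left ones, because a reduced word is built from its tail by
  multiplication with letters on the left.\<close>

definition right_span :: "('a, 'x) ring_scheme \<Rightarrow> nat \<Rightarrow> (nat \<Rightarrow> 'a) \<Rightarrow> 'a set" where
  "right_span R n v =
     {(\<Oplus>\<^bsub>R\<^esub>i\<in>{..<n}. v i \<otimes>\<^bsub>R\<^esub> s i) | s. s \<in> {..<n} \<rightarrow> carrier R}"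

definition center :: "('a, 'x) ring_scheme \<Rightarrow> 'a set" where
  "center R = {c \<in> carrier R. \<forall>z\<in>carrier R. c \<otimes>\<^bsub>R\<^esub> z = z \<otimes>\<^bsub>R\<^esub> c}"

context ring
begin

lemma right_spanE:
  assumes "a \<in> right_span R n v"
  obtains s where "s \<in> {..<n} \<rightarrow> carrier R" "a = (\<Oplus>i\<in>{..<n}. v i \<otimes> s i)"
  using assms by (auto simp: right_span_def)

lemma right_span_closed:
  "v \<in> {..<n} \<rightarrow> carrier R \<Longrightarrow> a \<in> right_span R n v \<Longrightarrow> a \<in> carrier R"
  by (auto simp: right_span_def Pi_iff intro!: finsum_closed)

lemma right_span_add:
  assumes "v \<in> {..<n} \<rightarrow> carrier R" "a \<in> right_span R n v" "b \<in> right_span R n v"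
  shows "a \<oplus> b \<in> right_span R n v"
proof -
  obtain s t where st: "s \<in> {..<n} \<rightarrow> carrier R" "a = (\<Oplus>i\<in>{..<n}. v i \<otimes> s i)"
    "t \<in> {..<n} \<rightarrow> carrier R" "b = (\<Oplus>i\<in>{..<n}. v i \<otimes> t i)"
    using assms by (auto elim!: right_spanE)
  have "a \<oplus> b = (\<Oplus>i\<in>{..<n}. v i \<otimes> s i \<oplus> v i \<otimes> t i)"
    using st assms by (subst finsum_addf) (auto simp: Pi_iff)
  also have "\<dots> = (\<Oplus>i\<in>{..<n}. v i \<otimes> (s i \<oplus> t i))"
    using st assms by (intro finsum_cong') (auto simp: r_distr Pi_iff)
  finally show ?thesis
    using st unfolding right_span_def by (auto intro!: exI[of _ "\<lambda>i. s i \<oplus> t i"] simp: Pi_iff)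
qed

lemma right_span_mult:
  assumes "v \<in> {..<n} \<rightarrow> carrier R" "a \<in> right_span R n v" "r \<in> carrier R"
  shows "a \<otimes> r \<in> right_span R n v"
proof -
  obtain s where s: "s \<in> {..<n} \<rightarrow> carrier R" "a = (\<Oplus>i\<in>{..<n}. v i \<otimes> s i)"
    using assms by (auto elim!: right_spanE)
  have "a \<otimes> r = (\<Oplus>i\<in>{..<n}. v i \<otimes> s i \<otimes> r)"
    using s assms by (subst s(2), subst finsum_ldistr) (auto simp: Pi_iff)
  also have "\<dots> = (\<Oplus>i\<in>{..<n}. v i \<otimes> (s i \<otimes> r))"
    using s assms by (intro finsum_cong') (auto simp: m_assoc Pi_iff)
  finally show ?thesis
    using s assms unfolding right_span_def by (auto intro!: exI[of _ "\<lambda>i. s i \<otimes> r"] simp: Pi_iff)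
qed

lemma right_span_zero: "v \<in> {..<n} \<rightarrow> carrier R \<Longrightarrow> \<zero> \<in> right_span R n v"
  unfolding right_span_def
  by (auto intro!: exI[of _ "\<lambda>i. \<zero>"] add.finprod_one_eqI[symmetric] simp: Pi_iff)

lemma right_span_generator:
  assumes "v \<in> {..<n} \<rightarrow> carrier R" "i < n" "r \<in> carrier R"
  shows "v i \<otimes> r \<in> right_span R n v"
proof -
  have "(\<Oplus>j\<in>{..<n}. v j \<otimes> (if i = j then r else \<zero>))
      = (\<Oplus>j\<in>{..<n}. if i = j then v j \<otimes> r else \<zero>)"
    using assms by (intro finsum_cong') (auto simp: Pi_iff)
  also have "\<dots> = v i \<otimes> r"
    using assms by (intro finsum_singleton) (auto simp: Pi_iff)
  finally show ?thesis
    using assms unfolding right_span_def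
    by (auto intro!: exI[of _ "\<lambda>j. if i = j then r else \<zero>"])
qed

lemma right_span_minus:
  assumes v: "v \<in> {..<n} \<rightarrow> carrier R" and a: "a \<in> right_span R n v" and b: "b \<in> right_span R n v"
  shows "a \<ominus> b \<in> right_span R n v"
proof -
  have "b \<otimes> (\<ominus> \<one>) = \<ominus> b"
    using right_span_closed[OF v b] by (simp add: r_minus)
  then show ?thesis
    using right_span_add[OF v a right_span_mult[OF v b, of "\<ominus> \<one>"]] by (simp add: a_minus_def)
qed

end

section \<open>The ring structure of a group algebra\<close>

locale field_group_algebra = field K + G: group G for K (structure) and G (structure)
begin

abbreviation A where "A \<equiv> group_algebra K G"

definition supp where "supp f = {g \<in> carrier G. f g \<noteq> \<zero>}"

text \<open>The linear extension to the group algebra of a function on the group. The sum is over the support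
  because \<open>finsum\<close> over an infinite set is not a sum.\<close>

definition lin_ext where "lin_ext \<phi> f = (\<Oplus>g\<in>supp f. f g \<otimes> \<phi> g)"

definition monomial where "monomial k g = (\<lambda>h\<in>carrier G. if h = g then k else \<zero>)"

lemma carrier_iff:
  "f \<in> carrier A \<longleftrightarrow> f \<in> carrier G \<rightarrow>\<^sub>E carrier K \<and> finite (supp f)"
  by (simp add: group_algebra_def supp_def)

lemma coeff_closed [simp, intro]: "f \<in> carrier A \<Longrightarrow> g \<in> carrier G \<Longrightarrow> f g \<in> carrier K"
  by (auto simp: carrier_iff)

lemma finite_supp [simp]: "f \<in> carrier A \<Longrightarrow> finite (supp f)"
  by (simp add: carrier_iff)

lemma supp_subset: "supp f \<subseteq> carrier G"
  by (auto simp: supp_def)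

lemma supp_closed [simp]: "g \<in> supp f \<Longrightarrow> g \<in> carrier G"
  by (auto simp: supp_def)

lemma coeff_outside_supp: "g \<in> carrier G \<Longrightarrow> g \<notin> supp f \<Longrightarrow> f g = \<zero>"
  by (auto simp: supp_def simp del: supp_closed)

lemma algebra_add_apply [simp]: "g \<in> carrier G \<Longrightarrow> (f \<oplus>\<^bsub>A\<^esub> h) g = f g \<oplus> h g"
  by (simp add: group_algebra_def)

lemma algebra_mult_apply: "g \<in> carrier G \<Longrightarrow>
    (f \<otimes>\<^bsub>A\<^esub> h) g = (\<Oplus>x\<in>supp f. f x \<otimes> h (inv\<^bsub>G\<^esub> x \<otimes>\<^bsub>G\<^esub> g))"
  by (simp add: group_algebra_def supp_def del: supp_closed)

lemma algebra_zero_apply [simp]: "g \<in> carrier G \<Longrightarrow> \<zero>\<^bsub>A\<^esub> g = \<zero>"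
  by (simp add: group_algebra_def)

lemma monomial_apply: "h \<in> carrier G \<Longrightarrow> monomial k g h = (if h = g then k else \<zero>)"
  by (simp add: monomial_def)

lemma one_eq_monomial: "\<one>\<^bsub>A\<^esub> = monomial \<one> \<one>\<^bsub>G\<^esub>"
  by (simp add: group_algebra_def monomial_def)

lemma supp_monomial: "supp (monomial k g) \<subseteq> {g}"
  by (auto simp: supp_def monomial_def simp del: supp_closed)

lemma monomial_closed [simp]: "k \<in> carrier K \<Longrightarrow> monomial k g \<in> carrier A"
  using finite_subset[OF supp_monomial] by (auto simp: carrier_iff monomial_def)

lemma algebra_zero_closed [simp]: "\<zero>\<^bsub>A\<^esub> \<in> carrier A"
  by (auto simp: carrier_iff supp_def group_algebra_def simp del: supp_closed)

lemma algebra_one_closed [simp]: "\<one>\<^bsub>A\<^esub> \<in> carrier A"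
  by (simp add: one_eq_monomial)

lemma algebra_eqI:
  assumes "f \<in> carrier A" "h \<in> carrier A" "\<And>g. g \<in> carrier G \<Longrightarrow> f g = h g"
  shows "f = h"
  using assms by (auto simp: carrier_iff intro: PiE_ext)

lemma supp_add: "supp (f \<oplus>\<^bsub>A\<^esub> h) \<subseteq> supp f \<union> supp h"
  by (auto simp: supp_def simp del: supp_closed)

lemma algebra_add_closed [simp]:
  assumes "f \<in> carrier A" "h \<in> carrier A"
  shows "f \<oplus>\<^bsub>A\<^esub> h \<in> carrier A"
proof -
  have "finite (supp (f \<oplus>\<^bsub>A\<^esub> h))"
    using assms by (intro finite_subset[OF supp_add]) auto
  then show ?thesis
    using assms by (auto simp: carrier_iff) (auto simp: group_algebra_def)
qed

lemma supp_mult: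
  assumes "f \<in> carrier A" "h \<in> carrier A"
  shows "supp (f \<otimes>\<^bsub>A\<^esub> h) \<subseteq> (\<lambda>(x, y). x \<otimes>\<^bsub>G\<^esub> y) ` (supp f \<times> supp h)"
proof
  fix g assume g: "g \<in> supp (f \<otimes>\<^bsub>A\<^esub> h)"
  \<comment> \<open>Otherwise every term of the convolution sum at \<open>g\<close> would vanish.\<close>
  have "\<exists>x\<in>supp f. h (inv\<^bsub>G\<^esub> x \<otimes>\<^bsub>G\<^esub> g) \<noteq> \<zero>"
  proof (rule ccontr)
    assume "\<not> ?thesis"
    then have "(f \<otimes>\<^bsub>A\<^esub> h) g = \<zero>"
      using g assms by (auto simp: algebra_mult_apply intro!: add.finprod_one_eqI)
    with g show False
      by (simp add: supp_def del: supp_closed)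
  qed
  then obtain x where x: "x \<in> supp f" "h (inv\<^bsub>G\<^esub> x \<otimes>\<^bsub>G\<^esub> g) \<noteq> \<zero>" by blast
  then have "inv\<^bsub>G\<^esub> x \<otimes>\<^bsub>G\<^esub> g \<in> supp h" "g = x \<otimes>\<^bsub>G\<^esub> (inv\<^bsub>G\<^esub> x \<otimes>\<^bsub>G\<^esub> g)"
    using g by (auto simp: supp_def G.m_assoc[symmetric] simp del: supp_closed)
  with x show "g \<in> (\<lambda>(x, y). x \<otimes>\<^bsub>G\<^esub> y) ` (supp f \<times> supp h)"
    by force
qed

lemma algebra_mult_closed [simp]:
  assumes "f \<in> carrier A" "h \<in> carrier A"
  shows "f \<otimes>\<^bsub>A\<^esub> h \<in> carrier A"
proof -
  have "finite (supp (f \<otimes>\<^bsub>A\<^esub> h))"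
    using assms by (intro finite_subset[OF supp_mult]) auto
  moreover have "f \<otimes>\<^bsub>A\<^esub> h \<in> extensional (carrier G)"
    by (simp add: group_algebra_def)
  moreover have "(f \<otimes>\<^bsub>A\<^esub> h) g \<in> carrier K" if "g \<in> carrier G" for g
    using that assms by (auto simp: algebra_mult_apply intro!: finsum_closed)
  ultimately show ?thesis
    by (simp add: carrier_iff PiE_def Pi_iff del: coeff_closed)
qed

lemma lin_ext_superset:
  assumes "f \<in> carrier A" "\<phi> \<in> carrier G \<rightarrow> carrier K"
    and "finite S" "supp f \<subseteq> S" "S \<subseteq> carrier G"
  shows "lin_ext \<phi> f = (\<Oplus>g\<in>S. f g \<otimes> \<phi> g)"
  unfolding lin_ext_def using assms
  by (intro add.finprod_mono_neutral_cong_left)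
    (auto simp: coeff_outside_supp Pi_iff subset_iff)

lemma lin_ext_closed [simp]:
  "f \<in> carrier A \<Longrightarrow> \<phi> \<in> carrier G \<rightarrow> carrier K \<Longrightarrow> lin_ext \<phi> f \<in> carrier K"
  unfolding lin_ext_def by (auto simp: Pi_iff intro!: finsum_closed)

lemma lin_ext_cong:
  assumes "f \<in> carrier A" "\<psi> \<in> carrier G \<rightarrow> carrier K" "\<And>g. g \<in> carrier G \<Longrightarrow> \<phi> g = \<psi> g"
  shows "lin_ext \<phi> f = lin_ext \<psi> f"
  unfolding lin_ext_def using assms by (intro finsum_cong') (auto simp: Pi_iff)

lemma lin_ext_add [simp]:
  assumes "f \<in> carrier A" "h \<in> carrier A" "\<phi> \<in> carrier G \<rightarrow> carrier K"
  shows "lin_ext \<phi> (f \<oplus>\<^bsub>A\<^esub> h) = lin_ext \<phi> f \<oplus> lin_ext \<phi> h"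
proof -
  let ?S = "supp f \<union> supp h"
  have S: "finite ?S" "?S \<subseteq> carrier G" "supp (f \<oplus>\<^bsub>A\<^esub> h) \<subseteq> ?S"
    using assms supp_subset supp_add by auto
  have "lin_ext \<phi> (f \<oplus>\<^bsub>A\<^esub> h) = (\<Oplus>g\<in>?S. (f \<oplus>\<^bsub>A\<^esub> h) g \<otimes> \<phi> g)"
    using S assms by (intro lin_ext_superset) auto
  also have "\<dots> = (\<Oplus>g\<in>?S. f g \<otimes> \<phi> g \<oplus> h g \<otimes> \<phi> g)"
    using assms by (intro finsum_cong') (auto simp: l_distr Pi_iff)
  also have "\<dots> = (\<Oplus>g\<in>?S. f g \<otimes> \<phi> g) \<oplus> (\<Oplus>g\<in>?S. h g \<otimes> \<phi> g)"
    using assms by (intro finsum_addf) (auto simp: Pi_iff)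
  also have "\<dots> = lin_ext \<phi> f \<oplus> lin_ext \<phi> h"
    using S assms lin_ext_superset[of f \<phi> ?S] lin_ext_superset[of h \<phi> ?S] by simp
  finally show ?thesis .
qed

lemma lin_ext_add_functional:
  assumes "f \<in> carrier A" "\<phi> \<in> carrier G \<rightarrow> carrier K" "\<psi> \<in> carrier G \<rightarrow> carrier K"
  shows "lin_ext (\<lambda>g. \<phi> g \<oplus> \<psi> g) f = lin_ext \<phi> f \<oplus> lin_ext \<psi> f"
proof -
  have "lin_ext (\<lambda>g. \<phi> g \<oplus> \<psi> g) f = (\<Oplus>g\<in>supp f. f g \<otimes> \<phi> g \<oplus> f g \<otimes> \<psi> g)"
    unfolding lin_ext_def using assms by (intro finsum_cong') (auto simp: r_distr Pi_iff)
  also have "\<dots> = lin_ext \<phi> f \<oplus> lin_ext \<psi> f"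
    unfolding lin_ext_def using assms by (intro finsum_addf) (auto simp: Pi_iff)
  finally show ?thesis .
qed

lemma lin_ext_scale_functional:
  assumes "f \<in> carrier A" "\<phi> \<in> carrier G \<rightarrow> carrier K" "c \<in> carrier K"
  shows "lin_ext (\<lambda>g. c \<otimes> \<phi> g) f = c \<otimes> lin_ext \<phi> f"
  unfolding lin_ext_def using assms
  by (subst finsum_rdistr) (auto intro!: finsum_cong' simp: m_lcomm Pi_iff)

lemma lin_ext_monomial [simp]:
  assumes "k \<in> carrier K" "g \<in> carrier G" "\<phi> \<in> carrier G \<rightarrow> carrier K"
  shows "lin_ext \<phi> (monomial k g) = k \<otimes> \<phi> g"
proof -
  have "\<phi> g \<in> carrier K" using assms by auto
  then show ?thesis
    using assms supp_monomial[of k g]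
    by (subst lin_ext_superset[where S = "{g}"]) (auto simp: monomial_apply finsum_insert)
qed

text \<open>Coefficients are themselves functionals, so the functionals separate the elements of the group
  algebra; this reduces identities between elements to identities between iterated sums.\<close>

lemma lin_ext_delta:
  assumes "f \<in> carrier A" "g \<in> carrier G"
  shows "lin_ext (\<lambda>x. if x = g then \<one> else \<zero>) f = f g"
proof -
  have "lin_ext (\<lambda>x. if x = g then \<one> else \<zero>) f
      = (\<Oplus>x\<in>insert g (supp f). f x \<otimes> (if x = g then \<one> else \<zero>))"
    using assms by (intro lin_ext_superset) auto
  also have "\<dots> = (\<Oplus>x\<in>insert g (supp f). if g = x then f x else \<zero>)"
    using assms by (intro finsum_cong') auto
  also have "\<dots> = f g"
    using assms by (intro finsum_singleton) auto
  finally show ?thesis .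
qed

lemma algebra_eqI_functionals:
  assumes "f \<in> carrier A" "h \<in> carrier A"
    and "\<And>\<phi>. \<phi> \<in> carrier G \<rightarrow> carrier K \<Longrightarrow> lin_ext \<phi> f = lin_ext \<phi> h"
  shows "f = h"
  using assms(1,2)
proof (rule algebra_eqI)
  fix g assume g: "g \<in> carrier G"
  then show "f g = h g"
    using assms(3)[of "\<lambda>x. if x = g then \<one> else \<zero>"] assms(1,2) by (simp add: lin_ext_delta)
qed

text \<open>The product is the bilinear extension of the multiplication of the group. Both the ring axioms
  and the behaviour of characters and derivations are read off from this formula. For the proof, the outer
  sum is taken over the finite set \<open>P\<close> of products of support elements, which contains the support
  of the product; then the two sums are exchanged and the inner one is translated by \<open>x\<close>.\<close>

lemma lin_ext_mult:
  assumes f: "f \<in> carrier A" and h: "h \<in> carrier A" and \<phi>: "\<phi> \<in> carrier G \<rightarrow> carrier K"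
  shows "lin_ext \<phi> (f \<otimes>\<^bsub>A\<^esub> h) = lin_ext (\<lambda>x. lin_ext (\<lambda>y. \<phi> (x \<otimes>\<^bsub>G\<^esub> y)) h) f"
proof -
  define P where "P = (\<lambda>(x, y). x \<otimes>\<^bsub>G\<^esub> y) ` (supp f \<times> supp h)"
  have P: "finite P" "P \<subseteq> carrier G" "supp (f \<otimes>\<^bsub>A\<^esub> h) \<subseteq> P"
    using f h supp_mult[OF f h] by (auto simp: P_def)
  have \<phi>' [simp]: "\<phi> g \<in> carrier K" if "g \<in> carrier G" for g
    using \<phi> that by auto
  have translate: "(\<Oplus>g\<in>P. h (inv\<^bsub>G\<^esub> x \<otimes>\<^bsub>G\<^esub> g) \<otimes> \<phi> g) = lin_ext (\<lambda>y. \<phi> (x \<otimes>\<^bsub>G\<^esub> y)) h"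
    if x: "x \<in> supp f" for x
  proof -
    let ?T = "(\<lambda>y. x \<otimes>\<^bsub>G\<^esub> y) ` supp h"
    have T: "?T \<subseteq> P" using x by (auto simp: P_def)
    have inj: "inj_on (\<lambda>y. x \<otimes>\<^bsub>G\<^esub> y) (supp h)"
      using x by (auto intro!: inj_onI)
    have "h (inv\<^bsub>G\<^esub> x \<otimes>\<^bsub>G\<^esub> g) = \<zero>" if "g \<in> P - ?T" for g
    proof (rule coeff_outside_supp)
      have g: "g \<in> carrier G" "g \<notin> ?T" using that P by auto
      then show "inv\<^bsub>G\<^esub> x \<otimes>\<^bsub>G\<^esub> g \<in> carrier G" using x by simp
      have "g = x \<otimes>\<^bsub>G\<^esub> (inv\<^bsub>G\<^esub> x \<otimes>\<^bsub>G\<^esub> g)"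
        using g x by (simp add: G.m_assoc[symmetric])
      with g show "inv\<^bsub>G\<^esub> x \<otimes>\<^bsub>G\<^esub> g \<notin> supp h" by blast
    qed
    then have "(\<Oplus>g\<in>P. h (inv\<^bsub>G\<^esub> x \<otimes>\<^bsub>G\<^esub> g) \<otimes> \<phi> g) = (\<Oplus>g\<in>?T. h (inv\<^bsub>G\<^esub> x \<otimes>\<^bsub>G\<^esub> g) \<otimes> \<phi> g)"
      using P T x h by (intro add.finprod_mono_neutral_cong_right) (auto dest: subsetD)
    also have "\<dots> = (\<Oplus>y\<in>supp h. h (inv\<^bsub>G\<^esub> x \<otimes>\<^bsub>G\<^esub> (x \<otimes>\<^bsub>G\<^esub> y)) \<otimes> \<phi> (x \<otimes>\<^bsub>G\<^esub> y))"
      using x h inj by (intro finsum_reindex) auto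
    also have "\<dots> = lin_ext (\<lambda>y. \<phi> (x \<otimes>\<^bsub>G\<^esub> y)) h"
      unfolding lin_ext_def using x h
      by (intro finsum_cong') (auto simp: G.m_assoc[symmetric])
    finally show ?thesis .
  qed
  have "lin_ext \<phi> (f \<otimes>\<^bsub>A\<^esub> h)
      = (\<Oplus>g\<in>P. (\<Oplus>x\<in>supp f. f x \<otimes> h (inv\<^bsub>G\<^esub> x \<otimes>\<^bsub>G\<^esub> g)) \<otimes> \<phi> g)"
    using P f h \<phi> by (subst lin_ext_superset[where S = P])
      (auto intro!: finsum_cong' finsum_closed simp: algebra_mult_apply subset_iff)
  also have "\<dots> = (\<Oplus>g\<in>P. \<Oplus>x\<in>supp f. f x \<otimes> (h (inv\<^bsub>G\<^esub> x \<otimes>\<^bsub>G\<^esub> g) \<otimes> \<phi> g))"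
  proof (intro finsum_cong' refl)
    fix g assume "g \<in> P"
    then have "g \<in> carrier G" using P by auto
    then show "(\<Oplus>x\<in>supp f. f x \<otimes> h (inv\<^bsub>G\<^esub> x \<otimes>\<^bsub>G\<^esub> g)) \<otimes> \<phi> g
        = (\<Oplus>x\<in>supp f. f x \<otimes> (h (inv\<^bsub>G\<^esub> x \<otimes>\<^bsub>G\<^esub> g) \<otimes> \<phi> g))"
      using f h by (subst finsum_ldistr) (auto intro!: finsum_cong' simp: m_assoc)
  qed (use P f h in \<open>auto intro!: finsum_closed simp: subset_iff\<close>)
  also have "\<dots> = (\<Oplus>x\<in>supp f. \<Oplus>g\<in>P. f x \<otimes> (h (inv\<^bsub>G\<^esub> x \<otimes>\<^bsub>G\<^esub> g) \<otimes> \<phi> g))"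
    using P f h by (intro finsum_swap) (auto simp: subset_iff)
  also have "\<dots> = lin_ext (\<lambda>x. lin_ext (\<lambda>y. \<phi> (x \<otimes>\<^bsub>G\<^esub> y)) h) f"
    unfolding lin_ext_def[of _ f]
  proof (intro finsum_cong' refl)
    fix x assume x: "x \<in> supp f"
    have "(\<Oplus>g\<in>P. f x \<otimes> (h (inv\<^bsub>G\<^esub> x \<otimes>\<^bsub>G\<^esub> g) \<otimes> \<phi> g))
        = f x \<otimes> (\<Oplus>g\<in>P. h (inv\<^bsub>G\<^esub> x \<otimes>\<^bsub>G\<^esub> g) \<otimes> \<phi> g)"
      using P f h x by (subst finsum_rdistr) (auto simp: subset_iff)
    with x show "(\<Oplus>g\<in>P. f x \<otimes> (h (inv\<^bsub>G\<^esub> x \<otimes>\<^bsub>G\<^esub> g) \<otimes> \<phi> g))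
        = f x \<otimes> lin_ext (\<lambda>y. \<phi> (x \<otimes>\<^bsub>G\<^esub> y)) h"
      by (simp add: translate)
  qed (use f h in auto)
  finally show ?thesis .
qed

lemma algebra_neg_closed:
  assumes "f \<in> carrier A"
  shows "(\<lambda>g\<in>carrier G. \<ominus> f g) \<in> carrier A"
proof -
  have "supp (\<lambda>g\<in>carrier G. \<ominus> f g) \<subseteq> supp f"
    by (auto simp: supp_def simp del: supp_closed)
  then have "finite (supp (\<lambda>g\<in>carrier G. \<ominus> f g))"
    using assms finite_subset finite_supp by blast
  with assms show ?thesis
    by (simp add: carrier_iff)
qed

text \<open>By \<open>lin_ext_mult\<close>, every functional takes both sides of the associative law to the same triple sum,
  by associativity in the group.\<close>

lemma ring_group_algebra: "ring A"
proof (rule ringI)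
  show "abelian_group A"
  proof (rule abelian_groupI)
    fix f assume f: "f \<in> carrier A"
    have "(\<lambda>g\<in>carrier G. \<ominus> f g) \<oplus>\<^bsub>A\<^esub> f = \<zero>\<^bsub>A\<^esub>"
      using f algebra_neg_closed[OF f] by (intro algebra_eqI) (auto simp: l_neg)
    then show "\<exists>h\<in>carrier A. h \<oplus>\<^bsub>A\<^esub> f = \<zero>\<^bsub>A\<^esub>"
      using algebra_neg_closed[OF f] by blast
  qed (auto intro!: algebra_eqI simp: a_ac)
next
  show "monoid A"
  proof (rule monoidI)
    fix f h k assume c: "f \<in> carrier A" "h \<in> carrier A" "k \<in> carrier A"
    show "f \<otimes>\<^bsub>A\<^esub> h \<otimes>\<^bsub>A\<^esub> k = f \<otimes>\<^bsub>A\<^esub> (h \<otimes>\<^bsub>A\<^esub> k)"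
    proof (rule algebra_eqI_functionals)
      fix \<phi> assume \<phi>: "\<phi> \<in> carrier G \<rightarrow> carrier K"
      let ?B = "\<lambda>x y. lin_ext (\<lambda>z. \<phi> (x \<otimes>\<^bsub>G\<^esub> y \<otimes>\<^bsub>G\<^esub> z)) k"
      have translate: "(\<lambda>z. \<phi> (x \<otimes>\<^bsub>G\<^esub> z)) \<in> carrier G \<rightarrow> carrier K" if "x \<in> carrier G" for x
        using \<phi> that by auto
      have B: "?B x \<in> carrier G \<rightarrow> carrier K" if "x \<in> carrier G" for x
        using c that by (auto simp: translate)
      have "lin_ext \<phi> (f \<otimes>\<^bsub>A\<^esub> h \<otimes>\<^bsub>A\<^esub> k) = lin_ext (\<lambda>x. lin_ext (?B x) h) f"
        using c \<phi> by (subst lin_ext_mult; simp add: translate Pi_I)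
          (subst lin_ext_mult; simp add: translate Pi_I)
      also have "\<dots> = lin_ext \<phi> (f \<otimes>\<^bsub>A\<^esub> (h \<otimes>\<^bsub>A\<^esub> k))"
      proof -
        have "lin_ext (?B x) h = lin_ext (\<lambda>z. \<phi> (x \<otimes>\<^bsub>G\<^esub> z)) (h \<otimes>\<^bsub>A\<^esub> k)" if x: "x \<in> carrier G" for x
          using c x \<phi> by (subst lin_ext_mult)
            (auto simp: G.m_assoc Pi_iff intro!: lin_ext_cong)
        then show ?thesis
          using c \<phi> by (subst lin_ext_mult) (auto simp: translate Pi_I intro!: lin_ext_cong)
      qed
      finally show "lin_ext \<phi> (f \<otimes>\<^bsub>A\<^esub> h \<otimes>\<^bsub>A\<^esub> k) = lin_ext \<phi> (f \<otimes>\<^bsub>A\<^esub> (h \<otimes>\<^bsub>A\<^esub> k))" .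
    qed (use c in auto)
  next
    fix f assume f: "f \<in> carrier A"
    have unit: "lin_ext \<phi> (\<one>\<^bsub>A\<^esub> \<otimes>\<^bsub>A\<^esub> f) = lin_ext \<phi> f \<and> lin_ext \<phi> (f \<otimes>\<^bsub>A\<^esub> \<one>\<^bsub>A\<^esub>) = lin_ext \<phi> f"
      if \<phi>: "\<phi> \<in> carrier G \<rightarrow> carrier K" for \<phi>
    proof -
      have translate: "(\<lambda>z. \<phi> (x \<otimes>\<^bsub>G\<^esub> z)) \<in> carrier G \<rightarrow> carrier K" if "x \<in> carrier G" for x
        using \<phi> that by auto
      have "lin_ext \<phi> (\<one>\<^bsub>A\<^esub> \<otimes>\<^bsub>A\<^esub> f) = lin_ext (\<lambda>y. \<phi> (\<one>\<^bsub>G\<^esub> \<otimes>\<^bsub>G\<^esub> y)) f"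
        using f \<phi> translate by (simp add: lin_ext_mult one_eq_monomial Pi_I)
      also have "\<dots> = lin_ext \<phi> f"
        using f \<phi> by (intro lin_ext_cong) auto
      finally have "lin_ext \<phi> (\<one>\<^bsub>A\<^esub> \<otimes>\<^bsub>A\<^esub> f) = lin_ext \<phi> f" .
      moreover have "lin_ext \<phi> (f \<otimes>\<^bsub>A\<^esub> \<one>\<^bsub>A\<^esub>) = lin_ext (\<lambda>x. lin_ext (\<lambda>y. \<phi> (x \<otimes>\<^bsub>G\<^esub> y)) \<one>\<^bsub>A\<^esub>) f"
        using f \<phi> by (intro lin_ext_mult) auto
      moreover have "\<dots> = lin_ext \<phi> f"
        using f \<phi> translate by (intro lin_ext_cong) (auto simp: one_eq_monomial Pi_iff)
      ultimately show ?thesis by simp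
    qed
    show "\<one>\<^bsub>A\<^esub> \<otimes>\<^bsub>A\<^esub> f = f" "f \<otimes>\<^bsub>A\<^esub> \<one>\<^bsub>A\<^esub> = f"
      using f unit by (auto intro!: algebra_eqI_functionals)
  qed auto
next
  fix f h k assume c: "f \<in> carrier A" "h \<in> carrier A" "k \<in> carrier A"
  show "(f \<oplus>\<^bsub>A\<^esub> h) \<otimes>\<^bsub>A\<^esub> k = f \<otimes>\<^bsub>A\<^esub> k \<oplus>\<^bsub>A\<^esub> h \<otimes>\<^bsub>A\<^esub> k"
    using c by (intro algebra_eqI_functionals) (auto simp: lin_ext_mult Pi_iff)
  show "k \<otimes>\<^bsub>A\<^esub> (f \<oplus>\<^bsub>A\<^esub> h) = k \<otimes>\<^bsub>A\<^esub> f \<oplus>\<^bsub>A\<^esub> k \<otimes>\<^bsub>A\<^esub> h"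
  proof (rule algebra_eqI_functionals)
    fix \<phi> assume \<phi>: "\<phi> \<in> carrier G \<rightarrow> carrier K"
    have "lin_ext \<phi> (k \<otimes>\<^bsub>A\<^esub> (f \<oplus>\<^bsub>A\<^esub> h))
       = lin_ext (\<lambda>x. lin_ext (\<lambda>y. \<phi> (x \<otimes>\<^bsub>G\<^esub> y)) f \<oplus> lin_ext (\<lambda>y. \<phi> (x \<otimes>\<^bsub>G\<^esub> y)) h) k"
      using c \<phi> by (auto simp: lin_ext_mult Pi_iff intro!: lin_ext_cong)
    also have "\<dots> = lin_ext \<phi> (k \<otimes>\<^bsub>A\<^esub> f \<oplus>\<^bsub>A\<^esub> k \<otimes>\<^bsub>A\<^esub> h)"
      using c \<phi> by (subst lin_ext_add_functional) (auto simp: lin_ext_mult Pi_iff)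
    finally show "lin_ext \<phi> (k \<otimes>\<^bsub>A\<^esub> (f \<oplus>\<^bsub>A\<^esub> h)) = lin_ext \<phi> (k \<otimes>\<^bsub>A\<^esub> f \<oplus>\<^bsub>A\<^esub> k \<otimes>\<^bsub>A\<^esub> h)" .
  qed (use c in auto)
qed

end

section \<open>Monomials, scalars and the centre\<close>

context field_group_algebra
begin

sublocale A: ring A
  by (rule ring_group_algebra)

lemma algebra_induct [consumes 1, case_names zero monomial add]:
  assumes f: "f \<in> carrier A"
    and zero: "P \<zero>\<^bsub>A\<^esub>"
    and monomial: "\<And>k g. k \<in> carrier K \<Longrightarrow> g \<in> carrier G \<Longrightarrow> P (monomial k g)"
    and add: "\<And>f h. f \<in> carrier A \<Longrightarrow> h \<in> carrier A \<Longrightarrow> P f \<Longrightarrow> P h \<Longrightarrow> P (f \<oplus>\<^bsub>A\<^esub> h)"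
  shows "P f"
proof -
  have "P f" if "finite S" "f \<in> carrier A" "supp f \<subseteq> S" for S f
    using that
  proof (induction S arbitrary: f)
    case empty
    then have "f = \<zero>\<^bsub>A\<^esub>"
      by (intro algebra_eqI) (auto simp: coeff_outside_supp)
    with zero show ?case by simp
  next
    case (insert g S)
    show ?case
    proof (cases "g \<in> carrier G")
      case False
      then have "supp f \<subseteq> S" using insert.prems supp_subset by auto
      with insert show ?thesis by blast
    next
      case g: True
      define h where "h = (\<lambda>x\<in>carrier G. if x = g then \<zero> else f x)"
      have h_supp: "supp h \<subseteq> S"
        using insert.prems by (auto simp: supp_def h_def simp del: supp_closed)
      then have h: "h \<in> carrier A"
        using insert.prems \<open>finite S\<close>
        by (auto simp: carrier_iff h_def intro: finite_subset)
      have "f = h \<oplus>\<^bsub>A\<^esub> monomial (f g) g"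
        using g h insert.prems by (intro algebra_eqI) (auto simp: h_def monomial_apply)
      then show ?thesis
        using add[OF h monomial_closed insert.IH[OF h h_supp] monomial[OF _ g], of "f g"] g insert.prems
        by simp
    qed
  qed
  with f show ?thesis by (meson finite_supp order_refl)
qed

lemma monomial_mult:
  assumes "k \<in> carrier K" "l \<in> carrier K" "g \<in> carrier G" "h \<in> carrier G"
  shows "monomial k g \<otimes>\<^bsub>A\<^esub> monomial l h = monomial (k \<otimes> l) (g \<otimes>\<^bsub>G\<^esub> h)"
  using assms
  by (intro algebra_eqI_functionals) (auto simp: lin_ext_mult m_assoc Pi_iff)

lemma monomial_add:
  "k \<in> carrier K \<Longrightarrow> l \<in> carrier K \<Longrightarrow> monomial k g \<oplus>\<^bsub>A\<^esub> monomial l g = monomial (k \<oplus> l) g"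
  by (intro algebra_eqI) (auto simp: monomial_apply)

abbreviation scalar where "scalar k \<equiv> monomial k \<one>\<^bsub>G\<^esub>"

lemma scalar_one: "scalar \<one> = \<one>\<^bsub>A\<^esub>"
  by (simp add: one_eq_monomial)

lemma scalar_zero: "scalar \<zero> = \<zero>\<^bsub>A\<^esub>"
  by (intro algebra_eqI) (auto simp: monomial_apply)

lemma scalar_commute:
  assumes k: "k \<in> carrier K" and f: "f \<in> carrier A"
  shows "scalar k \<otimes>\<^bsub>A\<^esub> f = f \<otimes>\<^bsub>A\<^esub> scalar k"
  using f
proof (induction rule: algebra_induct)
  case (monomial l g)
  with k show ?case by (simp add: monomial_mult m_comm)
next
  case (add f h)
  with k show ?case by (simp add: A.l_distr A.r_distr)
qed (use k in simp)

lemma scalar_in_center: "k \<in> carrier K \<Longrightarrow> scalar k \<in> center A"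
  by (auto simp: center_def scalar_commute)

lemma scalar_minus:
  assumes "k \<in> carrier K" "l \<in> carrier K"
  shows "scalar k \<ominus>\<^bsub>A\<^esub> scalar l = scalar (k \<ominus> l)"
proof -
  have "scalar (k \<ominus> l) \<oplus>\<^bsub>A\<^esub> scalar l = scalar k"
    using assms by (simp add: monomial_add a_minus_def a_assoc l_neg)
  then show ?thesis
    using assms A.add.inv_solve_right[of "scalar (k \<ominus> l)" "scalar k" "scalar l"]
    by (simp add: A.minus_eq)
qed

text \<open>Multiplication by a group element shifts the coefficients.\<close>

lemma monomial_mult_apply:
  assumes f: "f \<in> carrier A" and x: "x \<in> carrier G" and g: "g \<in> carrier G"
  shows "(monomial \<one> x \<otimes>\<^bsub>A\<^esub> f) (x \<otimes>\<^bsub>G\<^esub> g) = f g"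
    and "(f \<otimes>\<^bsub>A\<^esub> monomial \<one> x) (g \<otimes>\<^bsub>G\<^esub> x) = f g"
proof -
  let ?\<delta> = "\<lambda>g x. if x = g then \<one> else \<zero>"
  have "(monomial \<one> x \<otimes>\<^bsub>A\<^esub> f) (x \<otimes>\<^bsub>G\<^esub> g) = lin_ext (\<lambda>y. ?\<delta> (x \<otimes>\<^bsub>G\<^esub> g) (x \<otimes>\<^bsub>G\<^esub> y)) f"
    using assms by (subst lin_ext_delta[symmetric]) (auto simp: lin_ext_mult Pi_iff)
  also have "\<dots> = lin_ext (?\<delta> g) f"
    using assms by (intro lin_ext_cong) auto
  finally show "(monomial \<one> x \<otimes>\<^bsub>A\<^esub> f) (x \<otimes>\<^bsub>G\<^esub> g) = f g"
    using assms by (simp add: lin_ext_delta)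
  have "(f \<otimes>\<^bsub>A\<^esub> monomial \<one> x) (g \<otimes>\<^bsub>G\<^esub> x)
      = lin_ext (\<lambda>y. lin_ext (\<lambda>z. ?\<delta> (g \<otimes>\<^bsub>G\<^esub> x) (y \<otimes>\<^bsub>G\<^esub> z)) (monomial \<one> x)) f"
    using assms by (subst lin_ext_delta[symmetric]) (auto simp: lin_ext_mult Pi_iff)
  also have "\<dots> = lin_ext (?\<delta> g) f"
    using assms by (intro lin_ext_cong) auto
  finally show "(f \<otimes>\<^bsub>A\<^esub> monomial \<one> x) (g \<otimes>\<^bsub>G\<^esub> x) = f g"
    using assms by (simp add: lin_ext_delta)
qed

text \<open>Commuting with the group elements makes the coefficients of \<open>z\<close> constant on conjugacy classes.
  A nontrivial support element of maximal length would then have a longer conjugate in the support.\<close>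

lemma center_eq_scalars:
  fixes len :: "'c \<Rightarrow> nat"
  assumes longer: "\<And>g. g \<in> carrier G \<Longrightarrow> g \<noteq> \<one>\<^bsub>G\<^esub> \<Longrightarrow>
      \<exists>h\<in>carrier G. len g < len (h \<otimes>\<^bsub>G\<^esub> g \<otimes>\<^bsub>G\<^esub> inv\<^bsub>G\<^esub> h)"
    and z: "z \<in> center A"
  shows "z \<in> scalar ` carrier K"
proof -
  have zA: "z \<in> carrier A" and comm: "\<And>f. f \<in> carrier A \<Longrightarrow> z \<otimes>\<^bsub>A\<^esub> f = f \<otimes>\<^bsub>A\<^esub> z"
    using z by (auto simp: center_def)
  have class_function: "z (h \<otimes>\<^bsub>G\<^esub> g \<otimes>\<^bsub>G\<^esub> inv\<^bsub>G\<^esub> h) = z g" if "g \<in> carrier G" "h \<in> carrier G" for g h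
  proof -
    have "z g = (monomial \<one> h \<otimes>\<^bsub>A\<^esub> z) (h \<otimes>\<^bsub>G\<^esub> g)"
      using that zA by (simp add: monomial_mult_apply)
    also have "\<dots> = (z \<otimes>\<^bsub>A\<^esub> monomial \<one> h) (h \<otimes>\<^bsub>G\<^esub> g \<otimes>\<^bsub>G\<^esub> inv\<^bsub>G\<^esub> h \<otimes>\<^bsub>G\<^esub> h)"
      using that comm by (simp add: G.m_assoc)
    also have "\<dots> = z (h \<otimes>\<^bsub>G\<^esub> g \<otimes>\<^bsub>G\<^esub> inv\<^bsub>G\<^esub> h)"
      using that zA by (intro monomial_mult_apply) auto
    finally show ?thesis by simp
  qed
  have "supp z \<subseteq> {\<one>\<^bsub>G\<^esub>}"
  proof (rule ccontr)
    assume "\<not> ?thesis"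
    then have "supp z - {\<one>\<^bsub>G\<^esub>} \<noteq> {}" by auto
    then have "Max (len ` (supp z - {\<one>\<^bsub>G\<^esub>})) \<in> len ` (supp z - {\<one>\<^bsub>G\<^esub>})"
      using finite_supp[OF zA] by (intro Max_in) auto
    then obtain g where g: "g \<in> supp z - {\<one>\<^bsub>G\<^esub>}"
        and "len g = Max (len ` (supp z - {\<one>\<^bsub>G\<^esub>}))"
      by (metis imageE)
    then have max: "len x \<le> len g" if "x \<in> supp z - {\<one>\<^bsub>G\<^esub>}" for x
      using finite_supp[OF zA] that by (auto intro!: Max_ge)
    from g have gG: "g \<in> carrier G" and g1: "g \<noteq> \<one>\<^bsub>G\<^esub>" and zg: "z g \<noteq> \<zero>"
      by (auto simp: supp_def simp del: supp_closed)
    obtain h where h: "h \<in> carrier G" "len g < len (h \<otimes>\<^bsub>G\<^esub> g \<otimes>\<^bsub>G\<^esub> inv\<^bsub>G\<^esub> h)"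
      using longer[OF gG g1] by blast
    have "h \<otimes>\<^bsub>G\<^esub> g \<otimes>\<^bsub>G\<^esub> inv\<^bsub>G\<^esub> h \<noteq> \<one>\<^bsub>G\<^esub>"
    proof
      assume "h \<otimes>\<^bsub>G\<^esub> g \<otimes>\<^bsub>G\<^esub> inv\<^bsub>G\<^esub> h = \<one>\<^bsub>G\<^esub>"
      then have "h \<otimes>\<^bsub>G\<^esub> g \<otimes>\<^bsub>G\<^esub> inv\<^bsub>G\<^esub> h \<otimes>\<^bsub>G\<^esub> h = h"
        using h(1) by simp
      then have "h \<otimes>\<^bsub>G\<^esub> g = h \<otimes>\<^bsub>G\<^esub> \<one>\<^bsub>G\<^esub>"
        using h(1) gG by (simp add: G.m_assoc)
      then show False
        using h(1) gG g1 by simp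
    qed
    moreover have "z (h \<otimes>\<^bsub>G\<^esub> g \<otimes>\<^bsub>G\<^esub> inv\<^bsub>G\<^esub> h) \<noteq> \<zero>"
      using class_function[OF gG h(1)] zg by simp
    ultimately have "h \<otimes>\<^bsub>G\<^esub> g \<otimes>\<^bsub>G\<^esub> inv\<^bsub>G\<^esub> h \<in> supp z - {\<one>\<^bsub>G\<^esub>}"
      using h(1) gG by (simp add: supp_def del: supp_closed)
    from max[OF this] h(2) show False by simp
  qed
  then have "z = scalar (z \<one>\<^bsub>G\<^esub>)"
    using zA by (intro algebra_eqI) (auto simp: monomial_apply intro!: coeff_outside_supp)
  then show ?thesis
    using zA by blast
qed

section \<open>Characters and derivations\<close>

lemma lin_ext_zero [simp]: "lin_ext \<phi> \<zero>\<^bsub>A\<^esub> = \<zero>"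
proof -
  have "supp \<zero>\<^bsub>A\<^esub> = {}" by (auto simp: supp_def simp del: supp_closed)
  then show ?thesis by (simp add: lin_ext_def)
qed

lemma lin_ext_finsum:
  assumes "finite I" "\<And>i. i \<in> I \<Longrightarrow> f i \<in> carrier A" "\<phi> \<in> carrier G \<rightarrow> carrier K"
  shows "lin_ext \<phi> (\<Oplus>\<^bsub>A\<^esub>i\<in>I. f i) = (\<Oplus>i\<in>I. lin_ext \<phi> (f i))"
  using assms
proof (induction I)
  case (insert i I)
  then show ?case
    by (simp add: A.finsum_insert finsum_insert Pi_iff A.finsum_closed)
qed simp

text \<open>The characters are the homomorphisms to the multiplicative group of \<open>K\<close>: since \<open>\<chi> \<one> = \<one>\<close>, all
  values are invertible.\<close>

definition character where
  "character \<chi> \<longleftrightarrow> \<chi> \<in> carrier G \<rightarrow> carrier K \<and> \<chi> \<one>\<^bsub>G\<^esub> = \<one> \<and>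
     (\<forall>x\<in>carrier G. \<forall>y\<in>carrier G. \<chi> (x \<otimes>\<^bsub>G\<^esub> y) = \<chi> x \<otimes> \<chi> y)"

lemma character_lin_ext_mult:
  assumes "character \<chi>" "f \<in> carrier A" "h \<in> carrier A"
  shows "lin_ext \<chi> (f \<otimes>\<^bsub>A\<^esub> h) = lin_ext \<chi> f \<otimes> lin_ext \<chi> h"
proof -
  have \<chi>: "\<chi> \<in> carrier G \<rightarrow> carrier K" using assms by (simp add: character_def)
  have "lin_ext \<chi> (f \<otimes>\<^bsub>A\<^esub> h) = lin_ext (\<lambda>x. lin_ext (\<lambda>y. \<chi> (x \<otimes>\<^bsub>G\<^esub> y)) h) f"
    using assms \<chi> by (intro lin_ext_mult)
  also have "\<dots> = lin_ext (\<lambda>x. lin_ext \<chi> h \<otimes> \<chi> x) f"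
  proof (intro lin_ext_cong)
    fix x assume x: "x \<in> carrier G"
    then have "lin_ext (\<lambda>y. \<chi> (x \<otimes>\<^bsub>G\<^esub> y)) h = lin_ext (\<lambda>y. \<chi> x \<otimes> \<chi> y) h"
      using assms \<chi> by (intro lin_ext_cong) (auto simp: character_def Pi_iff)
    also have "\<dots> = \<chi> x \<otimes> lin_ext \<chi> h"
      using assms \<chi> x by (intro lin_ext_scale_functional) auto
    finally show "lin_ext (\<lambda>y. \<chi> (x \<otimes>\<^bsub>G\<^esub> y)) h = lin_ext \<chi> h \<otimes> \<chi> x"
      using x \<chi> assms by (simp add: m_comm Pi_iff)
  qed (use assms \<chi> in \<open>auto simp: Pi_iff\<close>)
  also have "\<dots> = lin_ext \<chi> f \<otimes> lin_ext \<chi> h"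
    using assms \<chi> by (subst lin_ext_scale_functional) (auto simp: m_comm)
  finally show ?thesis .
qed

text \<open>If \<open>e\<close> is additive, then \<open>\<chi> e\<close> is a derivation along \<open>\<chi>\<close> on the group, because
  \<open>\<chi>(x y) e(x y) = \<chi>(x) e(x) \<chi>(y) + \<chi>(x) \<chi>(y) e(y)\<close>; the Leibniz rule extends
  to the group algebra by bilinearity.\<close>

lemma derivation_lin_ext_mult:
  assumes \<chi>: "character \<chi>" and e: "e \<in> carrier G \<rightarrow> carrier K"
      "\<And>x y. x \<in> carrier G \<Longrightarrow> y \<in> carrier G \<Longrightarrow> e (x \<otimes>\<^bsub>G\<^esub> y) = e x \<oplus> e y"
    and f: "f \<in> carrier A" and h: "h \<in> carrier A"
  defines "D \<equiv> lin_ext (\<lambda>x. \<chi> x \<otimes> e x)"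
  shows "D (f \<otimes>\<^bsub>A\<^esub> h) = D f \<otimes> lin_ext \<chi> h \<oplus> lin_ext \<chi> f \<otimes> D h"
proof -
  have \<chi>c: "\<chi> \<in> carrier G \<rightarrow> carrier K" using \<chi> by (simp add: character_def)
  have dc: "(\<lambda>x. \<chi> x \<otimes> e x) \<in> carrier G \<rightarrow> carrier K" using \<chi>c e(1) by auto
  have Dh: "D h \<in> carrier K" using h dc by (simp add: D_def)
  have Lh: "lin_ext \<chi> h \<in> carrier K" using h \<chi>c by simp
  have inner: "lin_ext (\<lambda>y. \<chi> (x \<otimes>\<^bsub>G\<^esub> y) \<otimes> e (x \<otimes>\<^bsub>G\<^esub> y)) h
      = lin_ext \<chi> h \<otimes> (\<chi> x \<otimes> e x) \<oplus> D h \<otimes> \<chi> x" if x: "x \<in> carrier G" for x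
  proof -
    have c: "\<chi> x \<in> carrier K" "e x \<in> carrier K" using x \<chi>c e(1) by auto
    have "lin_ext (\<lambda>y. \<chi> (x \<otimes>\<^bsub>G\<^esub> y) \<otimes> e (x \<otimes>\<^bsub>G\<^esub> y)) h
        = lin_ext (\<lambda>y. (\<chi> x \<otimes> e x) \<otimes> \<chi> y \<oplus> \<chi> x \<otimes> (\<chi> y \<otimes> e y)) h"
    proof (intro lin_ext_cong)
      fix y assume y: "y \<in> carrier G"
      then have "\<chi> y \<in> carrier K" "e y \<in> carrier K" using \<chi>c e(1) by auto
      then show "\<chi> (x \<otimes>\<^bsub>G\<^esub> y) \<otimes> e (x \<otimes>\<^bsub>G\<^esub> y) = (\<chi> x \<otimes> e x) \<otimes> \<chi> y \<oplus> \<chi> x \<otimes> (\<chi> y \<otimes> e y)"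
        using x y c \<chi> e(2) by (simp add: character_def r_distr m_ac)
    qed (use h c \<chi>c e(1) in \<open>auto simp: Pi_iff\<close>)
    also have "\<dots> = (\<chi> x \<otimes> e x) \<otimes> lin_ext \<chi> h \<oplus> \<chi> x \<otimes> D h"
      using h c \<chi>c dc unfolding D_def
      by (subst lin_ext_add_functional) (auto simp: lin_ext_scale_functional Pi_iff)
    finally show ?thesis
      using c Dh Lh by (simp add: m_comm)
  qed
  have "D (f \<otimes>\<^bsub>A\<^esub> h) = lin_ext (\<lambda>x. lin_ext (\<lambda>y. \<chi> (x \<otimes>\<^bsub>G\<^esub> y) \<otimes> e (x \<otimes>\<^bsub>G\<^esub> y)) h) f"
    unfolding D_def using f h dc by (rule lin_ext_mult)
  also have "\<dots> = lin_ext (\<lambda>x. lin_ext \<chi> h \<otimes> (\<chi> x \<otimes> e x) \<oplus> D h \<otimes> \<chi> x) f"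
    using f h Dh Lh \<chi>c e(1) inner by (intro lin_ext_cong) (auto simp: Pi_iff)
  also have "\<dots> = lin_ext \<chi> h \<otimes> D f \<oplus> D h \<otimes> lin_ext \<chi> f"
    using f Dh Lh \<chi>c dc unfolding D_def
    by (subst lin_ext_add_functional) (auto simp: lin_ext_scale_functional Pi_iff)
  finally show ?thesis
    using f Dh Lh \<chi>c dc by (simp add: m_comm D_def)
qed

end

section \<open>Free groups\<close>

abbreviation generator :: "'a \<Rightarrow> 'a letter list" where
  "generator x \<equiv> [(x, True)]"

lemma free_group_induct [consumes 1, case_names one mult inv]:
  fixes X :: "'a set"
  assumes "w \<in> carrier (free_group X)"
    and one: "P \<one>\<^bsub>free_group X\<^esub>"
    and mult: "\<And>x w. x \<in> X \<Longrightarrow> w \<in> carrier (free_group X) \<Longrightarrow> P w \<Longrightarrow>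
      P (generator x \<otimes>\<^bsub>free_group X\<^esub> w)"
    and inv: "\<And>x w. x \<in> X \<Longrightarrow> w \<in> carrier (free_group X) \<Longrightarrow> P w \<Longrightarrow>
      P (inv\<^bsub>free_group X\<^esub> (generator x) \<otimes>\<^bsub>free_group X\<^esub> w)"
  shows "P w"
  using assms(1)
proof (induction w)
  case Nil
  then show ?case using one by (simp add: free_group_def)
next
  case (Cons a w)
  interpret F: group "free_group X" by (rule group_free_group)
  obtain x b where a: "a = (x, b)" by force
  have w: "w \<in> carrier (free_group X)" "x \<in> X"
    using Cons.prems by (auto simp: free_group_def a dest: reduced_tl)
  have "a # w = [a] \<otimes>\<^bsub>free_group X\<^esub> w"
    using Cons.prems by (simp add: free_group_def reduce_reduced)
  moreover have "inv\<^bsub>free_group X\<^esub> (generator x) = [(x, False)]"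
    using w by (intro F.inv_equality)
      (auto simp: free_group_def reduce_def cancel_cons_def inv_letter_def)
  ultimately show ?case
    using mult[OF w(2,1) Cons.IH[OF w(1)]] inv[OF w(2,1) Cons.IH[OF w(1)]] a by (cases b) auto
qed

definition exponent_sum :: "'a \<Rightarrow> 'a letter list \<Rightarrow> int" where
  "exponent_sum x w = (\<Sum>a\<leftarrow>w. if fst a = x then (if snd a then 1 else -1) else 0)"

lemma exponent_sum_reduce: "exponent_sum x (reduce w) = exponent_sum x w"
proof (induction w)
  case (Cons a w)
  have "exponent_sum x (cancel_cons a v) = exponent_sum x (a # v)" for v
    by (cases v) (auto simp: exponent_sum_def cancel_cons_def inv_letter_def)
  with Cons show ?case by (simp add: reduce_def) (simp add: exponent_sum_def)
qed (simp add: reduce_def)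

lemma exponent_sum_mult:
  "exponent_sum x (u \<otimes>\<^bsub>free_group X\<^esub> v) = exponent_sum x u + exponent_sum x v"
  by (simp add: free_group_def exponent_sum_reduce) (simp add: exponent_sum_def)

lemma reduced_snoc:
  "reduced w \<Longrightarrow> w \<noteq> [] \<Longrightarrow> a \<noteq> inv_letter (last w) \<Longrightarrow> reduced (w @ [a])"
  by (induction w rule: reduced.induct) auto

text \<open>With two generators there are at least four letters, and only two of them can cancel in \<open>a w a\<inverse>\<close>:
  the inverse of the first letter of \<open>w\<close>, and the last letter of \<open>w\<close>. Any other letter \<open>a\<close> gives a reduced word that
  is longer by two.\<close>

lemma free_group_conjugate_longer:
  fixes x y :: 'a
  assumes xy: "x \<in> X" "y \<in> X" "x \<noteq> y" and w: "w \<in> carrier (free_group X)" "w \<noteq> \<one>\<^bsub>free_group X\<^esub>"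
  shows "\<exists>h\<in>carrier (free_group X).
    length w < length (h \<otimes>\<^bsub>free_group X\<^esub> w \<otimes>\<^bsub>free_group X\<^esub> inv\<^bsub>free_group X\<^esub> h)"
proof -
  interpret F: group "free_group X" by (rule group_free_group)
  have red: "reduced w" and ne: "w \<noteq> []" and letters: "set w \<subseteq> X \<times> UNIV"
    using w by (auto simp: free_group_def)
  have "\<exists>a\<in>X \<times> UNIV. a \<noteq> inv_letter (hd w) \<and> a \<noteq> last w"
  proof (rule ccontr)
    assume "\<not> ?thesis"
    then have "{(x, True), (x, False), (y, True)} \<subseteq> {inv_letter (hd w), last w}"
      using xy by auto
    then have "card {(x, True), (x, False), (y, True)} \<le> card {inv_letter (hd w), last w}"
      by (intro card_mono) auto
    also have "\<dots> \<le> 2" by (simp add: card_insert_if)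
    finally show False using xy by simp
  qed
  then obtain a where a: "a \<in> X \<times> UNIV" "a \<noteq> inv_letter (hd w)" "a \<noteq> last w" by blast
  have "reduced (a # w)"
    using red ne a(2) by (cases w) (auto simp: inv_letter_def prod_eq_iff)
  then have "reduced (a # w @ [inv_letter a])"
    using a(3) ne reduced_snoc[of "a # w" "inv_letter a"] by (auto simp: inv_letter_def prod_eq_iff)
  moreover have "inv\<^bsub>free_group X\<^esub> [a] = [inv_letter a]"
    using a(1) by (intro F.inv_equality)
      (auto simp: free_group_def reduce_def cancel_cons_def inv_letter_def)
  ultimately have "[a] \<otimes>\<^bsub>free_group X\<^esub> w \<otimes>\<^bsub>free_group X\<^esub> inv\<^bsub>free_group X\<^esub> [a] = a # w @ [inv_letter a]"
    by (simp add: free_group_def reduce_append_left reduce_reduced)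
  moreover have "[a] \<in> carrier (free_group X)"
    using a(1) by (auto simp: free_group_def)
  ultimately show ?thesis by (intro bexI[of _ "[a]"]) auto
qed

text \<open>What the argument needs of a free group of rank \<open>n \<ge> 2\<close>, stated so that it is invariant under
  isomorphism: a generating family \<open>x\<close> (as an induction principle), exponent sums \<open>e\<close>, which
  make the family independent modulo commutators, and a length for which nontrivial
  elements have longer conjugates.\<close>

locale free_basis = group F for F (structure) +
  fixes n :: nat and x :: "nat \<Rightarrow> 'a" and e :: "nat \<Rightarrow> 'a \<Rightarrow> int" and len :: "'a \<Rightarrow> nat"
  assumes basis_closed: "i < n \<Longrightarrow> x i \<in> carrier F"
    and exponent_mult: "g \<in> carrier F \<Longrightarrow> h \<in> carrier F \<Longrightarrow> e i (g \<otimes> h) = e i g + e i h"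
    and exponent_basis: "i < n \<Longrightarrow> e j (x i) = (if i = j then 1 else 0)"
    and conjugate_longer: "g \<in> carrier F \<Longrightarrow> g \<noteq> \<one> \<Longrightarrow>
      \<exists>h\<in>carrier F. len g < len (h \<otimes> g \<otimes> inv h)"
    and basis_induct [consumes 1, case_names one mult inv]: "g \<in> carrier F \<Longrightarrow> P \<one> \<Longrightarrow>
      (\<And>i g. i < n \<Longrightarrow> g \<in> carrier F \<Longrightarrow> P g \<Longrightarrow> P (x i \<otimes> g)) \<Longrightarrow>
      (\<And>i g. i < n \<Longrightarrow> g \<in> carrier F \<Longrightarrow> P g \<Longrightarrow> P (inv (x i) \<otimes> g)) \<Longrightarrow> P g"

text \<open>The generators, exponent sums and word length of the group of reduced words are transported along an
  isomorphism.\<close>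

lemma free_group_of_rank_basis:
  assumes "free_group_of_rank n F" "n \<ge> 2"
  obtains x e len where "free_basis F n x e len"
proof -
  let ?W = "free_group {..<n}"
  interpret F: group F using assms by (simp add: free_group_of_rank_def)
  interpret W: group ?W by (rule group_free_group)
  obtain f where f: "f \<in> iso F ?W"
    using assms by (auto simp: free_group_of_rank_def is_iso_def)
  define f' where "f' = inv_into (carrier F) f"
  have f': "f' \<in> iso ?W F"
    using f F.iso_set_sym by (simp add: f'_def)
  interpret f: group_hom F ?W f
    using f by unfold_locales (auto simp: iso_def)
  interpret f': group_hom ?W F f'
    using f' by unfold_locales (auto simp: iso_def)
  have ff' [simp]: "f (f' w) = w" if "w \<in> carrier ?W" for w
    using f that by (auto simp: f'_def iso_def bij_betw_def intro!: f_inv_into_f)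
  have f'f [simp]: "f' (f g) = g" if "g \<in> carrier F" for g
    using f that by (auto simp: f'_def iso_def bij_betw_def intro!: inv_into_f_f)
  have gen: "generator i \<in> carrier ?W" if "i < n" for i
    using that by (auto simp: free_group_def)
  have "free_basis F n (\<lambda>i. f' (generator i)) (\<lambda>i g. exponent_sum i (f g)) (\<lambda>g. length (f g))"
  proof (unfold_locales, goal_cases)
    case (1 i)
    then show ?case using gen by simp
  next
    case (2 g h i)
    then show ?case by (simp add: exponent_sum_mult)
  next
    case (3 i j)
    then show ?case using gen by (simp add: exponent_sum_def)
  next
    case (4 g)
    then have "f g \<noteq> \<one>\<^bsub>?W\<^esub>"
      by (metis f'.hom_one f'f)
    then obtain h where "h \<in> carrier ?W"
        "length (f g) < length (h \<otimes>\<^bsub>?W\<^esub> f g \<otimes>\<^bsub>?W\<^esub> inv\<^bsub>?W\<^esub> h)"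
      using free_group_conjugate_longer[of 0 "{..<n}" 1 "f g"] assms(2) 4 by auto
    then show ?case using 4 by (intro bexI[of _ "f' h"]) (auto simp: f'.hom_inv)
  next
    case (5 g P)
    have "P (f' w)" if "w \<in> carrier ?W" for w
      using that
    proof (induction rule: free_group_induct)
      case one
      show ?case using 5(2) by simp
    next
      case (mult i w)
      then show ?case using 5(3)[of i "f' w"] gen[of i] by simp
    next
      case (inv i w)
      then show ?case using 5(4)[of i "f' w"] gen[of i] by (simp add: f'.hom_inv)
    qed
    from this[of "f g"] show ?case using 5(1) by simp
  qed
  then show thesis by (rule that)
qed

section \<open>A first-order sentence\<close>

text \<open>In the group algebra of a nonabelian free group the centre is the field of scalars, so this
  asks for a right ideal of codimension one with \<open>n\<close> generators. Using the centre makes the condition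
  expressible in the language of rings.\<close>

definition has_central_complement :: "nat \<Rightarrow> ('a, 'x) ring_scheme \<Rightarrow> bool" where
  "has_central_complement n R \<longleftrightarrow>
     (\<exists>v\<in>{..<n} \<rightarrow> carrier R. \<one>\<^bsub>R\<^esub> \<notin> right_span R n v \<and>
        (\<forall>r\<in>carrier R. \<exists>c\<in>center R. \<exists>s\<in>right_span R n v. r = c \<oplus>\<^bsub>R\<^esub> s))"

primrec exists_block :: "nat \<Rightarrow> nat \<Rightarrow> rform \<Rightarrow> rform" where
  "exists_block a 0 p = p"
| "exists_block a (Suc k) p = Exists (a + k) (exists_block a k p)"

primrec combination_term :: "nat \<Rightarrow> nat \<Rightarrow> rterm" where
  "combination_term n 0 = Zero"
| "combination_term n (Suc k) = Add (Mult (Var k) (Var (n + k))) (combination_term n k)"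

definition forall_form :: "nat \<Rightarrow> rform \<Rightarrow> rform" where
  "forall_form x p = Neg (Exists x (Neg p))"

text \<open>Variables below \<open>n\<close> are the generators, those from \<open>n\<close> to \<open>2 n - 1\<close> the coefficients of a right
  linear combination of them; \<open>2 n\<close>, \<open>2 n + 1\<close> and \<open>2 n + 2\<close> are the element to be split, its
  central part, and the element with which the latter has to commute.\<close>

definition complement_sentence :: "nat \<Rightarrow> rform" where
  "complement_sentence n = exists_block 0 n (Conj
     (Neg (exists_block n n (Eq One (combination_term n n))))
     (forall_form (2 * n) (Exists (Suc (2 * n)) (Conj
        (forall_form (2 * n + 2)
          (Eq (Mult (Var (Suc (2 * n))) (Var (2 * n + 2))) (Mult (Var (2 * n + 2)) (Var (Suc (2 * n))))))
        (exists_block n n (Eq (Var (2 * n)) (Add (Var (Suc (2 * n))) (combination_term n n))))))))"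

lemma free_vars_exists_block: "free_vars (exists_block a k p) = free_vars p - {a..<a + k}"
  by (induction k) (auto simp: atLeastLessThanSuc)

lemma term_vars_combination_term: "term_vars (combination_term n k) = {..<k} \<union> {n..<n + k}"
  by (induction k) (auto simp: atLeastLessThanSuc lessThan_Suc)

lemma sentence_complement_sentence: "sentence (complement_sentence n)"
  by (auto simp: sentence_def complement_sentence_def forall_form_def free_vars_exists_block
      term_vars_combination_term)

definition override_block :: "nat \<Rightarrow> nat \<Rightarrow> (nat \<Rightarrow> 'a) \<Rightarrow> (nat \<Rightarrow> 'a) \<Rightarrow> nat \<Rightarrow> 'a" where
  "override_block a k f e = (\<lambda>i. if a \<le> i \<and> i < a + k then f (i - a) else e i)"

lemma sat_exists_block:
  "sat R e (exists_block a k p) \<longleftrightarrow>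
     (\<exists>f\<in>{..<k} \<rightarrow> carrier R. sat R (override_block a k f e) p)"
proof (induction k arbitrary: e)
  case 0
  have "override_block a 0 f e = e" for f by (auto simp: override_block_def fun_eq_iff)
  then show ?case by auto
next
  case (Suc k)
  have ext: "override_block a k f (e(a + k := b)) = override_block a (Suc k) (f(k := b)) e" for f b
    by (auto simp: override_block_def fun_eq_iff)
  have "sat R e (exists_block a (Suc k) p) \<longleftrightarrow>
      (\<exists>b\<in>carrier R. \<exists>f\<in>{..<k} \<rightarrow> carrier R. sat R (override_block a (Suc k) (f(k := b)) e) p)"
    by (simp only: exists_block.simps sat.simps Suc.IH ext)
  also have "\<dots> \<longleftrightarrow> (\<exists>f\<in>{..<Suc k} \<rightarrow> carrier R. sat R (override_block a (Suc k) f e) p)"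
  proof (intro iffI; elim bexE)
    fix b f assume "b \<in> carrier R" "f \<in> {..<k} \<rightarrow> carrier R"
      "sat R (override_block a (Suc k) (f(k := b)) e) p"
    then show "\<exists>f\<in>{..<Suc k} \<rightarrow> carrier R. sat R (override_block a (Suc k) f e) p"
      by (intro bexI[of _ "f(k := b)"]) (auto simp: Pi_iff)
  next
    fix f assume "f \<in> {..<Suc k} \<rightarrow> carrier R" "sat R (override_block a (Suc k) f e) p"
    then show "\<exists>b\<in>carrier R. \<exists>f\<in>{..<k} \<rightarrow> carrier R. sat R (override_block a (Suc k) (f(k := b)) e) p"
      by (intro bexI[of _ "f k"] bexI[of _ f]) (auto simp: Pi_iff)
  qed
  finally show ?case .
qed

lemma sat_forall_form: "sat R e (forall_form x p) \<longleftrightarrow> (\<forall>a\<in>carrier R. sat R (e(x := a)) p)"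
  by (simp add: forall_form_def)

context ring
begin

lemma term_val_combination_term:
  assumes "\<And>i. i < k \<Longrightarrow> e i \<in> carrier R" "\<And>i. i < k \<Longrightarrow> e (n + i) \<in> carrier R"
  shows "term_val R e (combination_term n k) = (\<Oplus>i\<in>{..<k}. e i \<otimes> e (n + i))"
  using assms
proof (induction k)
  case (Suc k)
  then show ?case by (simp add: lessThan_Suc finsum_insert Pi_iff)
qed simp

lemma term_val_combination_override:
  assumes "v \<in> {..<n} \<rightarrow> carrier R" "s \<in> {..<n} \<rightarrow> carrier R" "\<And>i. i < n \<Longrightarrow> e i = v i"
  shows "term_val R (override_block n n s e) (combination_term n n) = (\<Oplus>i\<in>{..<n}. v i \<otimes> s i)"
  using assms
  by (subst term_val_combination_term)
    (auto simp: override_block_def Pi_iff intro!: finsum_cong')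

lemma sat_complement_sentence:
  "sat R e (complement_sentence n) \<longleftrightarrow> has_central_complement n R"
proof -
  have one: "sat R e' (exists_block n n (Eq One (combination_term n n)))
      \<longleftrightarrow> \<one> \<in> right_span R n v"
    if "v \<in> {..<n} \<rightarrow> carrier R" "\<And>i. i < n \<Longrightarrow> e' i = v i" for v e'
    using that by (auto simp: sat_exists_block term_val_combination_override[of v] right_span_def)
  have split: "sat R e' (exists_block n n
        (Eq (Var (2 * n)) (Add (Var (Suc (2 * n))) (combination_term n n))))
      \<longleftrightarrow> (\<exists>s\<in>right_span R n v. e' (2 * n) = e' (Suc (2 * n)) \<oplus> s)"
    if "v \<in> {..<n} \<rightarrow> carrier R" "\<And>i. i < n \<Longrightarrow> e' i = v i" for v e'
  proof -
    have "override_block n n s e' (2 * n) = e' (2 * n)"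
      "override_block n n s e' (Suc (2 * n)) = e' (Suc (2 * n))" for s
      by (auto simp: override_block_def)
    then show ?thesis
      using that
      by (auto simp: sat_exists_block term_val_combination_override[of v] right_span_def)
  qed
  have center: "(\<exists>c\<in>center R. P c) \<longleftrightarrow>
      (\<exists>c\<in>carrier R. (\<forall>z\<in>carrier R. c \<otimes> z = z \<otimes> c) \<and> P c)" for P
    by (auto simp: center_def)
  show ?thesis
    unfolding complement_sentence_def has_central_complement_def sat_exists_block[of _ _ 0]
  proof (rule bex_cong[OF refl])
    fix v assume v: "v \<in> {..<n} \<rightarrow> carrier R"
    let ?e = "override_block 0 n v e"
    have e: "?e i = v i" if "i < n" for i
      using that by (simp add: override_block_def)
    show "sat R ?e (Conj (Neg (exists_block n n (Eq One (combination_term n n))))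
       (forall_form (2 * n) (Exists (Suc (2 * n)) (Conj
        (forall_form (2 * n + 2)
          (Eq (Mult (Var (Suc (2 * n))) (Var (2 * n + 2))) (Mult (Var (2 * n + 2)) (Var (Suc (2 * n))))))
        (exists_block n n (Eq (Var (2 * n)) (Add (Var (Suc (2 * n))) (combination_term n n)))))))) \<longleftrightarrow>
      \<one> \<notin> right_span R n v \<and>
        (\<forall>r\<in>carrier R. \<exists>c\<in>center R. \<exists>s\<in>right_span R n v. r = c \<oplus> s)"
      unfolding center
      using v e by (simp add: one[of v] split[of v] sat_forall_form)
  qed
qed

lemma models_complement_sentence:
  "models R (complement_sentence n) \<longleftrightarrow> has_central_complement n R"
proof -
  have "range (\<lambda>_::nat. \<zero>) \<subseteq> carrier R" by auto
  then show ?thesis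
    unfolding models_def sat_complement_sentence by blast
qed

end

section \<open>The rank of a free group in its group algebra\<close>

context field_group_algebra
begin

lemma character_one: "character (\<lambda>_. \<one>)"
  by (auto simp: character_def)

text \<open>The augmentation ideal works. It does not contain \<open>1\<close>, because the sum of the coefficients is
  multiplicative and vanishes at \<open>x\<^sub>i - 1\<close>. By induction on words every monomial is congruent to a
  scalar, because \<open>x\<^sub>i g = g + (x\<^sub>i - 1) g\<close> and \<open>x\<^sub>i\<inverse> g = g - (x\<^sub>i - 1) x\<^sub>i\<inverse> g\<close>.\<close>

lemma free_basis_imp_complement:
  assumes "free_basis G n x e len"
  shows "has_central_complement n A"
proof -
  interpret free_basis G n x e len by fact
  define v where "v i = monomial \<one> (x i) \<ominus>\<^bsub>A\<^esub> \<one>\<^bsub>A\<^esub>" for i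
  have v: "v \<in> {..<n} \<rightarrow> carrier A"
    by (auto simp: v_def)
  have aug_v: "lin_ext (\<lambda>_. \<one>) (v i) = \<zero>" if "i < n" for i
  proof -
    have "v i \<oplus>\<^bsub>A\<^esub> \<one>\<^bsub>A\<^esub> = monomial \<one> (x i)"
      by (simp add: v_def A.minus_eq A.a_assoc A.l_neg)
    then have "lin_ext (\<lambda>_. \<one>) (v i) \<oplus> lin_ext (\<lambda>_. \<one>) \<one>\<^bsub>A\<^esub> = lin_ext (\<lambda>_. \<one>) (monomial \<one> (x i))"
      using v that by (subst lin_ext_add[symmetric]) (auto simp: Pi_iff)
    then show ?thesis
      using v that basis_closed by (simp add: one_eq_monomial Pi_iff)
  qed
  have "\<one>\<^bsub>A\<^esub> \<notin> right_span A n v"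
  proof
    assume "\<one>\<^bsub>A\<^esub> \<in> right_span A n v"
    then obtain s where s: "s \<in> {..<n} \<rightarrow> carrier A"
        "\<one>\<^bsub>A\<^esub> = (\<Oplus>\<^bsub>A\<^esub>i\<in>{..<n}. v i \<otimes>\<^bsub>A\<^esub> s i)"
      by (rule A.right_spanE)
    have "lin_ext (\<lambda>_. \<one>) \<one>\<^bsub>A\<^esub> = (\<Oplus>i\<in>{..<n}. lin_ext (\<lambda>_. \<one>) (v i \<otimes>\<^bsub>A\<^esub> s i))"
      unfolding s(2) using v s(1) by (intro lin_ext_finsum) auto
    also have "\<dots> = \<zero>"
      using v s(1) by (intro add.finprod_one_eqI)
        (auto simp: character_lin_ext_mult[OF character_one] aug_v Pi_iff)
    finally show False by (simp add: one_eq_monomial)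
  qed
  moreover have "\<exists>c\<in>center A. \<exists>s\<in>right_span A n v. f = c \<oplus>\<^bsub>A\<^esub> s" if "f \<in> carrier A" for f
  proof -
    let ?P = "\<lambda>f. \<exists>k\<in>carrier K. \<exists>s\<in>right_span A n v. f = scalar k \<oplus>\<^bsub>A\<^esub> s"
    have span_closed: "s \<in> carrier A" if "s \<in> right_span A n v" for s
      using A.right_span_closed[OF v that] .
    have add: "?P (f \<oplus>\<^bsub>A\<^esub> s)" if fs: "?P f" "s \<in> right_span A n v" for f s
    proof -
      obtain k t where kt: "k \<in> carrier K" "t \<in> right_span A n v" "f = scalar k \<oplus>\<^bsub>A\<^esub> t"
        using fs(1) by blast
      then have "f \<oplus>\<^bsub>A\<^esub> s = scalar k \<oplus>\<^bsub>A\<^esub> (t \<oplus>\<^bsub>A\<^esub> s)"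
        using span_closed fs(2) by (simp add: A.a_assoc)
      then show ?thesis
        using kt A.right_span_add[OF v kt(2) fs(2)] by blast
    qed
    have step: "monomial k (x i \<otimes>\<^bsub>G\<^esub> g) = monomial k g \<oplus>\<^bsub>A\<^esub> v i \<otimes>\<^bsub>A\<^esub> monomial k g"
      if "i < n" "g \<in> carrier G" "k \<in> carrier K" for i g k
    proof -
      have "v i \<otimes>\<^bsub>A\<^esub> monomial k g = monomial \<one> (x i) \<otimes>\<^bsub>A\<^esub> monomial k g \<ominus>\<^bsub>A\<^esub> monomial k g"
        using that by (simp add: v_def A.minus_eq A.l_distr A.l_minus)
      also have "\<dots> = monomial k (x i \<otimes>\<^bsub>G\<^esub> g) \<ominus>\<^bsub>A\<^esub> monomial k g"
        using that basis_closed by (simp add: monomial_mult)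
      finally have "v i \<otimes>\<^bsub>A\<^esub> monomial k g = monomial k (x i \<otimes>\<^bsub>G\<^esub> g) \<ominus>\<^bsub>A\<^esub> monomial k g" .
      moreover have "a = b \<oplus>\<^bsub>A\<^esub> (a \<ominus>\<^bsub>A\<^esub> b)" if "a \<in> carrier A" "b \<in> carrier A" for a b
        using that A.a_lcomm[of b a "\<ominus>\<^bsub>A\<^esub> b"] by (simp add: A.minus_eq A.r_neg)
      ultimately show ?thesis
        using that by simp
    qed
    have monomials: "?P (monomial k g)" if k: "k \<in> carrier K" and g: "g \<in> carrier G" for k g
      using g
    proof (induction rule: basis_induct)
      case one
      show ?case
        using k A.right_span_zero[OF v] by (intro bexI[of _ k] bexI[of _ "\<zero>\<^bsub>A\<^esub>"]) auto
    next
      case (mult i g)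
      then show ?case
        using k add[OF mult(3) A.right_span_generator[OF v, of i "monomial k g"]]
        by (simp add: step)
    next
      case (inv i g)
      let ?h = "inv\<^bsub>G\<^esub> (x i) \<otimes>\<^bsub>G\<^esub> g"
      have h: "?h \<in> carrier G" "x i \<otimes>\<^bsub>G\<^esub> ?h = g"
        using inv basis_closed by (auto simp: G.m_assoc[symmetric])
      have s: "v i \<otimes>\<^bsub>A\<^esub> monomial (\<ominus> k) ?h \<in> right_span A n v"
        using k inv(1) by (intro A.right_span_generator[OF v]) auto
      have "\<ominus>\<^bsub>A\<^esub> monomial k ?h = monomial (\<ominus> k) ?h"
        using k by (intro A.minus_equality algebra_eqI) (auto simp: monomial_apply l_neg)
      then have "v i \<otimes>\<^bsub>A\<^esub> monomial (\<ominus> k) ?h = \<ominus>\<^bsub>A\<^esub> (v i \<otimes>\<^bsub>A\<^esub> monomial k ?h)"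
        using k inv(1) v by (auto simp: A.r_minus[symmetric] Pi_iff)
      moreover have "monomial k g = monomial k ?h \<oplus>\<^bsub>A\<^esub> v i \<otimes>\<^bsub>A\<^esub> monomial k ?h"
        using step[OF inv(1) h(1) k] h(2) by simp
      ultimately have "monomial k ?h = monomial k g \<oplus>\<^bsub>A\<^esub> (v i \<otimes>\<^bsub>A\<^esub> monomial (\<ominus> k) ?h)"
        using k inv(1) v by (simp add: A.a_assoc A.r_neg Pi_iff)
      then show ?case
        using add[OF inv(3) s] by simp
    qed
    have "?P f"
      using that
    proof (induction rule: algebra_induct)
      case zero
      show ?case
        using A.right_span_zero[OF v] by (intro bexI[of _ \<zero>] bexI[of _ "\<zero>\<^bsub>A\<^esub>"]) (auto simp: scalar_zero)
    next
      case (monomial k g)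
      then show ?case by (rule monomials)
    next
      case (add f h)
      then obtain k s l t where kl: "k \<in> carrier K" "l \<in> carrier K"
          and st: "s \<in> right_span A n v" "t \<in> right_span A n v"
          and fh: "f = scalar k \<oplus>\<^bsub>A\<^esub> s" "h = scalar l \<oplus>\<^bsub>A\<^esub> t"
        by blast
      have "f \<oplus>\<^bsub>A\<^esub> h = (scalar k \<oplus>\<^bsub>A\<^esub> scalar l) \<oplus>\<^bsub>A\<^esub> (s \<oplus>\<^bsub>A\<^esub> t)"
        using kl st[THEN span_closed] by (simp add: fh A.a_ac)
      then show ?case
        using kl A.right_span_add[OF v st] by (auto simp: monomial_add)
    qed
    then show ?thesis
      using scalar_in_center by blast
  qed
  ultimately show ?thesis
    using v unfolding has_central_complement_def by blast
qed

text \<open>A nonzero scalar in \<open>I\<close> would be a unit, so \<open>K \<inter> I = 0\<close> and the scalar part of every element is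
  unique. It is multiplicative on the group: from \<open>g = \<chi>(g) + s\<close> and \<open>h = \<chi>(h) + t\<close> follows
  \<open>g h = \<chi>(g) \<chi>(h) + t \<chi>(g) + s h\<close>, where \<open>\<chi>(g) t = t \<chi>(g)\<close> lies in the right ideal because scalars are
  central. The scalar part of an arbitrary element \<open>f\<close> is then \<open>lin_ext \<chi> f\<close>, which is zero for
  \<open>f \<in> I\<close>.\<close>

lemma complement_character:
  assumes center: "center A \<subseteq> scalar ` carrier K" and compl: "has_central_complement n A"
  obtains v \<chi> where "v \<in> {..<n} \<rightarrow> carrier A" "character \<chi>"
    "\<And>k. k < n \<Longrightarrow> lin_ext \<chi> (v k) = \<zero>"
    "\<And>g. \<exists>s\<in>right_span A n v. monomial \<one> g = scalar (\<chi> g) \<oplus>\<^bsub>A\<^esub> s"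
proof -
  obtain v where v: "v \<in> {..<n} \<rightarrow> carrier A" and proper: "\<one>\<^bsub>A\<^esub> \<notin> right_span A n v"
    and split: "\<And>r. r \<in> carrier A \<Longrightarrow> \<exists>c\<in>center A. \<exists>s\<in>right_span A n v. r = c \<oplus>\<^bsub>A\<^esub> s"
    using compl unfolding has_central_complement_def by blast
  let ?I = "right_span A n v"
  note I_closed = A.right_span_closed[OF v] and I_add = A.right_span_add[OF v]
    and I_mult = A.right_span_mult[OF v]
  have no_scalar: "k = \<zero>" if k: "k \<in> carrier K" "scalar k \<in> ?I" for k
  proof (rule ccontr)
    assume "k \<noteq> \<zero>"
    then have "k \<in> Units K" using k(1) by (simp add: field_Units)
    then have inv: "inv k \<in> carrier K" "k \<otimes> inv k = \<one>" by auto
    then have "scalar k \<otimes>\<^bsub>A\<^esub> scalar (inv k) = \<one>\<^bsub>A\<^esub>"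
      using k(1) by (simp add: monomial_mult scalar_one)
    then show False
      using I_mult[OF k(2), of "scalar (inv k)"] inv proper by simp
  qed
  have unique: "k = l"
    if "k \<in> carrier K" "l \<in> carrier K" "s \<in> ?I" "t \<in> ?I" "scalar k \<oplus>\<^bsub>A\<^esub> s = scalar l \<oplus>\<^bsub>A\<^esub> t"
    for k l s t
  proof -
    have "scalar k = scalar l \<oplus>\<^bsub>A\<^esub> t \<ominus>\<^bsub>A\<^esub> s"
      using that I_closed A.add.inv_solve_right[of "scalar k" "scalar l \<oplus>\<^bsub>A\<^esub> t" s]
      by (simp add: A.minus_eq)
    then have "scalar k \<ominus>\<^bsub>A\<^esub> scalar l = t \<ominus>\<^bsub>A\<^esub> s"
      using that I_closed by (simp add: A.minus_eq A.a_ac A.r_neg A.r_neg1)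
    then have "scalar (k \<ominus> l) \<in> ?I"
      using that A.right_span_minus[OF v that(4,3)] by (simp add: scalar_minus)
    then have "k \<ominus> l = \<zero>" using that by (intro no_scalar) auto
    then show ?thesis using that sum_zero_eq_neg[of k "\<ominus> l"] by (simp add: minus_eq)
  qed
  have "\<exists>k. k \<in> carrier K \<and> (\<exists>s\<in>?I. monomial \<one> g = scalar k \<oplus>\<^bsub>A\<^esub> s)" for g
  proof -
    obtain c s where c: "c \<in> center A" and s: "s \<in> ?I" "monomial \<one> g = c \<oplus>\<^bsub>A\<^esub> s"
      using split[of "monomial \<one> g"] by auto
    obtain k where "k \<in> carrier K" "c = scalar k"
      using c center by blast
    with s show ?thesis by blast
  qed
  then obtain \<chi> where \<chi>: "\<And>g. \<chi> g \<in> carrier K"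
    and \<chi>_split: "\<And>g. \<exists>s\<in>?I. monomial \<one> g = scalar (\<chi> g) \<oplus>\<^bsub>A\<^esub> s"
    by metis
  have char: "character \<chi>"
    unfolding character_def
  proof (intro conjI ballI)
    show "\<chi> \<one>\<^bsub>G\<^esub> = \<one>"
    proof -
      obtain s where s: "s \<in> ?I" "scalar \<one> = scalar (\<chi> \<one>\<^bsub>G\<^esub>) \<oplus>\<^bsub>A\<^esub> s"
        using \<chi>_split[of "\<one>\<^bsub>G\<^esub>"] by blast
      have "scalar (\<chi> \<one>\<^bsub>G\<^esub>) \<oplus>\<^bsub>A\<^esub> s = scalar \<one> \<oplus>\<^bsub>A\<^esub> \<zero>\<^bsub>A\<^esub>"
        unfolding s(2)[symmetric] by simp
      then show ?thesis
        by (rule unique[OF \<chi> one_closed s(1) A.right_span_zero[OF v]])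
    qed
  next
    fix g h assume gh: "g \<in> carrier G" "h \<in> carrier G"
    obtain s t u where stu: "s \<in> ?I" "t \<in> ?I" "u \<in> ?I"
      and g: "monomial \<one> g = scalar (\<chi> g) \<oplus>\<^bsub>A\<^esub> s"
      and h: "monomial \<one> h = scalar (\<chi> h) \<oplus>\<^bsub>A\<^esub> t"
      and prod: "monomial \<one> (g \<otimes>\<^bsub>G\<^esub> h) = scalar (\<chi> (g \<otimes>\<^bsub>G\<^esub> h)) \<oplus>\<^bsub>A\<^esub> u"
      using \<chi>_split by meson
    have "monomial \<one> (g \<otimes>\<^bsub>G\<^esub> h) = (scalar (\<chi> g) \<oplus>\<^bsub>A\<^esub> s) \<otimes>\<^bsub>A\<^esub> monomial \<one> h"
      using gh by (simp add: g[symmetric] monomial_mult)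
    also have "\<dots> = scalar (\<chi> g) \<otimes>\<^bsub>A\<^esub> (scalar (\<chi> h) \<oplus>\<^bsub>A\<^esub> t) \<oplus>\<^bsub>A\<^esub> s \<otimes>\<^bsub>A\<^esub> monomial \<one> h"
      using \<chi> I_closed[OF stu(1)] by (simp add: A.l_distr h[symmetric])
    also have "\<dots> = scalar (\<chi> g \<otimes> \<chi> h) \<oplus>\<^bsub>A\<^esub> (t \<otimes>\<^bsub>A\<^esub> scalar (\<chi> g) \<oplus>\<^bsub>A\<^esub> s \<otimes>\<^bsub>A\<^esub> monomial \<one> h)"
      using \<chi> I_closed[OF stu(1)] I_closed[OF stu(2)]
      by (simp add: A.r_distr monomial_mult scalar_commute A.a_assoc)
    finally have "scalar (\<chi> (g \<otimes>\<^bsub>G\<^esub> h)) \<oplus>\<^bsub>A\<^esub> u = \<dots>" by (simp add: prod)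
    moreover have "t \<otimes>\<^bsub>A\<^esub> scalar (\<chi> g) \<oplus>\<^bsub>A\<^esub> s \<otimes>\<^bsub>A\<^esub> monomial \<one> h \<in> ?I"
      using \<chi> stu by (intro I_add I_mult) auto
    ultimately show "\<chi> (g \<otimes>\<^bsub>G\<^esub> h) = \<chi> g \<otimes> \<chi> h"
      using \<chi> stu by (intro unique) auto
  qed (use \<chi> in auto)
  have \<chi>_fun: "\<chi> \<in> carrier G \<rightarrow> carrier K" using \<chi> by auto
  have eval: "\<exists>s\<in>?I. f = scalar (lin_ext \<chi> f) \<oplus>\<^bsub>A\<^esub> s" if "f \<in> carrier A" for f
    using that
  proof (induction rule: algebra_induct)
    case zero
    show ?case
      using A.right_span_zero[OF v] by (intro bexI[of _ "\<zero>\<^bsub>A\<^esub>"]) (auto simp: scalar_zero)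
  next
    case (monomial k g)
    obtain s where s: "s \<in> ?I" "monomial \<one> g = scalar (\<chi> g) \<oplus>\<^bsub>A\<^esub> s"
      using \<chi>_split by blast
    have "monomial k g = monomial \<one> g \<otimes>\<^bsub>A\<^esub> scalar k"
      using monomial by (simp add: monomial_mult)
    also have "\<dots> = scalar (k \<otimes> \<chi> g) \<oplus>\<^bsub>A\<^esub> s \<otimes>\<^bsub>A\<^esub> scalar k"
      using monomial \<chi> I_closed[OF s(1)] by (simp add: s(2) A.l_distr monomial_mult m_comm)
    also have "k \<otimes> \<chi> g = lin_ext \<chi> (monomial k g)"
      using monomial \<chi>_fun by simp
    finally show ?case
      by (rule bexI[of _ "s \<otimes>\<^bsub>A\<^esub> scalar k"])
        (rule I_mult[OF s(1) monomial_closed[OF monomial(1)]])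
  next
    case (add f h)
    then obtain s t where st: "s \<in> ?I" "t \<in> ?I"
      and fh: "f = scalar (lin_ext \<chi> f) \<oplus>\<^bsub>A\<^esub> s" "h = scalar (lin_ext \<chi> h) \<oplus>\<^bsub>A\<^esub> t" by blast
    have c: "lin_ext \<chi> f \<in> carrier K" "lin_ext \<chi> h \<in> carrier K"
      using add \<chi>_fun by auto
    have "f \<oplus>\<^bsub>A\<^esub> h = (scalar (lin_ext \<chi> f) \<oplus>\<^bsub>A\<^esub> s) \<oplus>\<^bsub>A\<^esub> (scalar (lin_ext \<chi> h) \<oplus>\<^bsub>A\<^esub> t)"
      using fh by simp
    also have "\<dots> = (scalar (lin_ext \<chi> f) \<oplus>\<^bsub>A\<^esub> scalar (lin_ext \<chi> h)) \<oplus>\<^bsub>A\<^esub> (s \<oplus>\<^bsub>A\<^esub> t)"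
      using c I_closed[OF st(1)] I_closed[OF st(2)] by (simp add: A.a_ac)
    also have "\<dots> = scalar (lin_ext \<chi> (f \<oplus>\<^bsub>A\<^esub> h)) \<oplus>\<^bsub>A\<^esub> (s \<oplus>\<^bsub>A\<^esub> t)"
      using add \<chi>_fun c by (simp add: monomial_add)
    finally show ?case
      using I_add[OF st] by blast
  qed
  have vanish: "lin_ext \<chi> f = \<zero>" if f: "f \<in> ?I" for f
  proof -
    have fA: "f \<in> carrier A" using I_closed[OF f] .
    obtain s where s: "s \<in> ?I" "f = scalar (lin_ext \<chi> f) \<oplus>\<^bsub>A\<^esub> s"
      using eval[OF fA] by blast
    have "scalar (lin_ext \<chi> f) \<oplus>\<^bsub>A\<^esub> s = scalar \<zero> \<oplus>\<^bsub>A\<^esub> f"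
      using s(2) fA by (simp add: scalar_zero)
    then show ?thesis
      using unique[OF _ _ s(1) f] fA \<chi>_fun by simp
  qed
  have v_vanish: "lin_ext \<chi> (v k) = \<zero>" if "k < n" for k
    using vanish A.right_span_generator[OF v that, of "\<one>\<^bsub>A\<^esub>"] v that
    by (simp add: Pi_iff)
  show thesis
    using v char v_vanish \<chi>_split by (rule that)
qed

text \<open>This is the bound \<open>m \<le> dim (I / I\<^sup>2) \<le> n\<close>. On \<open>I\<close> the derivation rule loses one of its two terms,
  because \<open>\<chi>\<close> vanishes there, so \<open>D\<^sub>j\<close> of a right combination of the \<open>v\<^sub>k\<close> is a linear
  combination of the \<open>D\<^sub>j(v\<^sub>k)\<close>.\<close>

lemma complement_imp_rank_le:
  assumes basis: "free_basis G m x e len" and compl: "has_central_complement n A"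
  shows "m \<le> n"
proof -
  interpret free_basis G m x e len by fact
  have "center A \<subseteq> scalar ` carrier K"
    using center_eq_scalars[of len, OF conjugate_longer] by blast
  then obtain v \<chi> where v: "v \<in> {..<n} \<rightarrow> carrier A" and char: "character \<chi>"
    and v_vanish: "\<And>k. k < n \<Longrightarrow> lin_ext \<chi> (v k) = \<zero>"
    and \<chi>_split: "\<And>g. \<exists>s\<in>right_span A n v. monomial \<one> g = scalar (\<chi> g) \<oplus>\<^bsub>A\<^esub> s"
    using complement_character[OF _ compl] by blast
  have \<chi>_fun: "\<chi> \<in> carrier G \<rightarrow> carrier K" using char by (simp add: character_def)
  then have \<chi>: "\<And>i. i < m \<Longrightarrow> \<chi> (x i) \<in> carrier K" "\<chi> \<one>\<^bsub>G\<^esub> \<in> carrier K"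
    using basis_closed by auto
  define E where "E j g = [e j g] \<cdot> \<one>" for j g
  have E: "E j \<in> carrier G \<rightarrow> carrier K" for j
    by (auto simp: E_def)
  have E_mult: "E j (g \<otimes>\<^bsub>G\<^esub> h) = E j g \<oplus> E j h" if "g \<in> carrier G" "h \<in> carrier G" for j g h
    using that by (simp add: E_def exponent_mult add.int_pow_mult)
  define D where "D j = lin_ext (\<lambda>g. \<chi> g \<otimes> E j g)" for j
  have dc: "(\<lambda>g. \<chi> g \<otimes> E j g) \<in> carrier G \<rightarrow> carrier K" for j
    using \<chi>_fun E by (auto simp: Pi_iff)
  have D_closed: "D j f \<in> carrier K" if "f \<in> carrier A" for j f
    using that dc by (simp add: D_def)
  have D_mult: "D j (f \<otimes>\<^bsub>A\<^esub> h) = D j f \<otimes> lin_ext \<chi> h \<oplus> lin_ext \<chi> f \<otimes> D j h"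
    if "f \<in> carrier A" "h \<in> carrier A" for j f h
    unfolding D_def using char E E_mult that by (rule derivation_lin_ext_mult)
  have E_one: "E j \<one>\<^bsub>G\<^esub> = \<zero>" for j
    using E_mult[of "\<one>\<^bsub>G\<^esub>" "\<one>\<^bsub>G\<^esub>" j] E by (simp add: Pi_iff)
  have D_scalar: "D j (scalar k) = \<zero>" if "k \<in> carrier K" for j k
    using that dc \<chi> by (simp add: D_def E_one)
  have add_pow_int_zero: "[(0::int)] \<cdot> \<one> = \<zero>"
    by (simp add: add_pow_def)
  have D_basis: "D j (monomial \<one> (x i)) = (if i = j then \<chi> (x i) else \<zero>)" if "i < m" for i j
    using that dc \<chi> basis_closed by (simp add: D_def E_def exponent_basis add_pow_int_zero)
  have "\<forall>i. \<exists>s. s \<in> {..<n} \<rightarrow> carrier A \<and>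
      monomial \<one> (x i) = scalar (\<chi> (x i)) \<oplus>\<^bsub>A\<^esub> (\<Oplus>\<^bsub>A\<^esub>k\<in>{..<n}. v k \<otimes>\<^bsub>A\<^esub> s k)"
  proof
    fix i
    obtain t where t: "t \<in> right_span A n v" "monomial \<one> (x i) = scalar (\<chi> (x i)) \<oplus>\<^bsub>A\<^esub> t"
      using \<chi>_split by blast
    obtain s where "s \<in> {..<n} \<rightarrow> carrier A" "t = (\<Oplus>\<^bsub>A\<^esub>k\<in>{..<n}. v k \<otimes>\<^bsub>A\<^esub> s k)"
      using t(1) by (rule A.right_spanE)
    then show "\<exists>s. s \<in> {..<n} \<rightarrow> carrier A \<and>
        monomial \<one> (x i) = scalar (\<chi> (x i)) \<oplus>\<^bsub>A\<^esub> (\<Oplus>\<^bsub>A\<^esub>k\<in>{..<n}. v k \<otimes>\<^bsub>A\<^esub> s k)"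
      using t(2) by (intro exI[of _ s]) simp
  qed
  from choice[OF this] obtain s where s: "\<And>i. s i \<in> {..<n} \<rightarrow> carrier A"
    and s_eq: "\<And>i. monomial \<one> (x i) = scalar (\<chi> (x i)) \<oplus>\<^bsub>A\<^esub> (\<Oplus>\<^bsub>A\<^esub>k\<in>{..<n}. v k \<otimes>\<^bsub>A\<^esub> s i k)"
    by blast
  have vs: "v k \<in> carrier A" "s i k \<in> carrier A" if "k < n" for i k
    using v s[of i] that by auto
  show "m \<le> n"
  proof (rule diagonal_factorization_bound)
    show "lin_ext \<chi> (s i k) \<in> carrier K" if "k < n" for i k
      using vs that \<chi>_fun by simp
    show "D j (v k) \<in> carrier K" if "k < n" for k j
      using vs that D_closed by simp
    show "\<chi> (x i) \<in> carrier K - {\<zero>}" if "i < m" for i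
    proof -
      have "\<chi> (x i) \<otimes> \<chi> (inv\<^bsub>G\<^esub> (x i)) = \<one>"
        using char basis_closed[OF that] unfolding character_def
        by (metis G.inv_closed G.r_inv)
      moreover have "\<chi> (inv\<^bsub>G\<^esub> (x i)) \<in> carrier K"
        using \<chi>_fun basis_closed[OF that] by auto
      ultimately show ?thesis
        using \<chi>(1)[OF that] by (metis DiffI l_null one_not_zero singletonD)
    qed
    show "(\<Oplus>k\<in>{..<n}. lin_ext \<chi> (s i k) \<otimes> D j (v k)) = (if i = j then \<chi> (x i) else \<zero>)"
      if "i < m" for i j
    proof -
      have "D j (\<Oplus>\<^bsub>A\<^esub>k\<in>{..<n}. v k \<otimes>\<^bsub>A\<^esub> s i k) = (\<Oplus>k\<in>{..<n}. D j (v k \<otimes>\<^bsub>A\<^esub> s i k))"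
        unfolding D_def using vs dc by (intro lin_ext_finsum) auto
      also have "\<dots> = (\<Oplus>k\<in>{..<n}. lin_ext \<chi> (s i k) \<otimes> D j (v k))"
        using vs D_closed \<chi>_fun
        by (intro finsum_cong') (auto simp: D_mult v_vanish m_comm)
      finally have "(\<Oplus>k\<in>{..<n}. lin_ext \<chi> (s i k) \<otimes> D j (v k))
          = D j (scalar (\<chi> (x i))) \<oplus> D j (\<Oplus>\<^bsub>A\<^esub>k\<in>{..<n}. v k \<otimes>\<^bsub>A\<^esub> s i k)"
        using vs D_closed \<chi>(1)[OF that] \<chi>_fun by (simp add: D_scalar Pi_iff)
      also have "\<dots> = D j (monomial \<one> (x i))"
        unfolding D_def s_eq[of i] using vs dc \<chi>(1)[OF that]
        by (intro lin_ext_add[symmetric] A.finsum_closed) auto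
      finally show ?thesis using D_basis[OF that] by simp
    qed
  qed
qed

end

lemma group_algebra_models_complement_sentence:
  assumes "field K" "free_group_of_rank m F" "m \<ge> 2"
  shows "models (group_algebra K F) (complement_sentence m)"
    and "models (group_algebra K F) (complement_sentence n) \<Longrightarrow> m \<le> n"
proof -
  have "group F" using assms by (simp add: free_group_of_rank_def)
  then interpret field_group_algebra K F
    using assms by (intro field_group_algebra.intro)
  obtain x e len where basis: "free_basis F m x e len"
    using free_group_of_rank_basis[OF assms(2,3)] .
  show "models (group_algebra K F) (complement_sentence m)"
    using free_basis_imp_complement[OF basis] A.models_complement_sentence by blast
  show "m \<le> n" if "models (group_algebra K F) (complement_sentence n)"
    using that complement_imp_rank_le[OF basis] A.models_complement_sentence by blast
qed

theorem theorem16: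
  fixes K :: "('k, 'x) ring_scheme"
    and F :: "('g, 'y) monoid_scheme"
    and F' :: "('h, 'z) monoid_scheme"
    and n m :: nat
  assumes "field K" and "infinite (carrier K)"
    and "n \<ge> 2" and "m \<ge> 2" and "n \<noteq> m"
    and "free_group_of_rank n F" and "free_group_of_rank m F'"
  shows "\<not> elementarily_equivalent (group_algebra K F) (group_algebra K F')"
proof
  assume "elementarily_equivalent (group_algebra K F) (group_algebra K F')"
  then have equiv: "models (group_algebra K F) (complement_sentence k)
      \<longleftrightarrow> models (group_algebra K F') (complement_sentence k)" for k
    using sentence_complement_sentence by (simp add: elementarily_equivalent_def)
  have "m \<le> n"
    using group_algebra_models_complement_sentence[OF assms(1,6,3)]
      group_algebra_models_complement_sentence[OF assms(1,7,4)] equiv by blast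
  moreover have "n \<le> m"
    using group_algebra_models_complement_sentence[OF assms(1,6,3)]
      group_algebra_models_complement_sentence[OF assms(1,7,4)] equiv by blast
  ultimately show False
    using assms(5) by simp
qed

end
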